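(* Let $G_1,G_2,\dots,G_n,\dots$ be connected graphs with the same order (number of vertices) $k\ge 2$. Put \[ \varepsilon_n:=\sqrt{\frac{12}{(k^2-1)n}}. \] Let $X_n:=(\prod_{i=1}^n G_i,d_{X_n},m_{X_n})$ be the cartesian product graph equipped with the path metric $d_{X_n}$ and the uniform probability measure $m_{X_n}$ on its vertices, and put $Y_n:=(\prod_{i=1}^n G_i,\varepsilon_n\cdot d_{X_n},m_{X_n})$, $m_{Y_n}:=m_{X_n}$. Let $\{f_{n_i}\}_i$ be a subsequence of a sequence of 1-Lipschitz functions $f_n:Y_n\to\mathbb{R}$, $n=1,2,\dots$. If $(f_{n_i})_*m_{Y_{n_i}}$ converges weakly to a Borel probability measure $\sigma$ on $\mathbb{R}$, then $\gamma^1\succ'\sigma$, where $\gamma^1$ is the 1-dimensional (standard) Gaussian measure on $\mathbb{R}$.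
   Context: The path metric on the (vertex set of the) cartesian product graph $\prod_{i=1}^n G_i$ is $d_{X_n}((x_i),(y_i))=\sum_{i=1}^n d_{G_i}(x_i,y_i)$, where $d_{G_i}$ is the graph distance on $G_i$. 1-Lipschitz means Lipschitz with constant at most $1$; $f_*m$ is the push-forward of $m$ by $f$. For Borel probability measures $\mu,\nu$ on $\mathbb{R}$, $\mu\succ'\nu$ (iso-Lipschitz order) means that there exists a monotone non-decreasing 1-Lipschitz function $f:\operatorname{supp}\mu\to\operatorname{supp}\nu$ with $f_*\mu=\nu$. *)

theory Defs
  imports
    "HOL-Probability.Probability"
    "Graph_Theory.Digraph_Component"
    "Graph_Theory.Shortest_Path"
begin

text \<open>Every arc gets cost 1, so the cost of a walk is its number of arcs. The shortest-path value
  is an extended real; it is finite whenever a walk from u to v exists.\<close>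

definition graph_dist :: "('a, 'b) pre_digraph \<Rightarrow> 'a \<Rightarrow> 'a \<Rightarrow> real" where
  "graph_dist G u v = real_of_ereal (wf_digraph.\<mu> G (\<lambda>_. 1) u v)"

definition cart_prod_verts :: "(nat \<Rightarrow> ('a, 'b) pre_digraph) \<Rightarrow> nat \<Rightarrow> (nat \<Rightarrow> 'a) set" where
  "cart_prod_verts G n = (\<Pi>\<^sub>E i\<in>{1..n}. verts (G i))"

definition cart_prod_dist ::
  "(nat \<Rightarrow> ('a, 'b) pre_digraph) \<Rightarrow> nat \<Rightarrow> (nat \<Rightarrow> 'a) \<Rightarrow> (nat \<Rightarrow> 'a) \<Rightarrow> real" where
  "cart_prod_dist G n x y = (\<Sum>i\<in>{1..n}. graph_dist (G i) (x i) (y i))"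

definition cart_prod_measure :: "(nat \<Rightarrow> ('a, 'b) pre_digraph) \<Rightarrow> nat \<Rightarrow> (nat \<Rightarrow> 'a) measure" where
  "cart_prod_measure G n = uniform_count_measure (cart_prod_verts G n)"

definition scale_eps :: "nat \<Rightarrow> nat \<Rightarrow> real" where
  "scale_eps k n = sqrt (12 / (((real k)\<^sup>2 - 1) * real n))"

text \<open>The 1-Lipschitz property for a real function on a set S with an explicitly given distance d
  (the library's Lipschitz predicate requires a metric-space type class).\<close>

definition one_Lipschitz :: "'a set \<Rightarrow> ('a \<Rightarrow> 'a \<Rightarrow> real) \<Rightarrow> ('a \<Rightarrow> real) \<Rightarrow> bool" where
  "one_Lipschitz S d f \<longleftrightarrow> (\<forall>x\<in>S. \<forall>y\<in>S. \<bar>f x - f y\<bar> \<le> d x y)"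

text \<open>Intended for Borel measures only.\<close>

definition measure_supp :: "'a::topological_space measure \<Rightarrow> 'a set" where
  "measure_supp M = {x. \<forall>U. open U \<longrightarrow> x \<in> U \<longrightarrow> emeasure M U > 0}"

text \<open>Only the values of f on the support of M matter; the push-forward is therefore taken of M
  restricted to its support, which is a closed set of full measure for a Borel probability measure
  on the reals.\<close>

definition iso_Lipschitz_dominates :: "real measure \<Rightarrow> real measure \<Rightarrow> bool"
    (infix "\<succ>''" 50) where
  "M \<succ>' N \<longleftrightarrow>
    (\<exists>f. f \<in> measure_supp M \<rightarrow> measure_supp N \<and>
         mono_on (measure_supp M) f \<and>
         1-lipschitz_on (measure_supp M) f \<and>
         distr (restrict_space M (measure_supp M)) borel f = N)"

end

theory Submission
  imports Defs
begin

text \<open>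
  The proof is a Gaussian isoperimetric inequality for the weak limit, obtained from a functional
  inequality in the style of Bobkov. Let \<open>\<Phi>\<close> and \<open>\<phi>\<close> be the standard Gaussian distribution function and
  density. The isoperimetric profile \<open>I = \<phi> \<circ> \<Phi>\<inverse>\<close> satisfies \<open>I I'' = -1\<close>. For a function \<open>h\<close> of small
  oscillation on a finite uniform probability space, a second-order expansion turns this equation into
  \<open>I (E h) \<le> E (sqrt (I(h)\<^sup>2 + Var h))\<close>, up to an error that is small compared with the squared
  oscillation (\<open>gauss_profile_one_step\<close>). By Minkowski's inequality such inequalities can be combined
  over the factors of a product space, and the errors add up (\<open>bobkov_tensorization\<close>).

  The scale \<open>\<epsilon>\<^sub>n\<close> enters through the variance in one coordinate. On a connected graph with \<open>k\<close>
  vertices, the values of a function with increments at most \<open>L\<close> along edges have, once sorted,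
  consecutive gaps at most \<open>L\<close>; their variance is therefore at most that of the path,
  \<open>L\<^sup>2 (k\<^sup>2 - 1) / 12\<close> (\<open>variance_on_cut_connected\<close>). For \<open>L = \<epsilon>\<^sub>n\<close> this is \<open>1 / n\<close>, so the \<open>n\<close> coordinates
  contribute at most \<open>1\<close> in total, while the accumulated errors tend to \<open>0\<close>. Composing the Lipschitz
  functions with a smooth \<open>g\<close> whose values stay away from \<open>0\<close> and \<open>1\<close>, and passing to the weak limit, one
  gets \<open>I (\<integral> g d\<sigma>) \<le> \<integral> sqrt (I(g)\<^sup>2 + g'\<^sup>2) d\<sigma>\<close> (\<open>weak_limit_bobkov\<close>).

  For \<open>g x = \<Phi> (b - c x)\<close> the integrand on the right is just \<open>sqrt (1 + c\<^sup>2) \<phi> (b - c x)\<close>. Hence, with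
  \<open>N b = \<integral> \<Phi> (b - c x) d\<sigma>\<close>, the inequality is the differential inequality
  \<open>I (N b) \<le> sqrt (1 + c\<^sup>2) N' b\<close>, which says that \<open>\<Phi>\<inverse> \<circ> N\<close> has slope at least \<open>1 / sqrt (1 + c\<^sup>2)\<close>
  (\<open>smoothed_cdf_growth\<close>). Putting \<open>b = c s\<close> and letting \<open>c\<close> tend to infinity, \<open>N\<close> converges
  to the distribution function \<open>F\<close> of \<open>\<sigma>\<close> outside the atoms of \<open>\<sigma>\<close>, and \<open>\<Phi>\<inverse> \<circ> F\<close> grows at least at unit speed (\<open>cdf_growth\<close>).
  Equivalently, the monotone transport map \<open>F\<inverse> \<circ> \<Phi>\<close> from the Gaussian measure to \<open>\<sigma>\<close> is
  1-Lipschitz (\<open>std_normal_dominates\<close>).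
\<close>

section \<open>The Gaussian isoperimetric profile\<close>

definition gauss_cdf :: "real \<Rightarrow> real" where
  "gauss_cdf = cdf std_normal_distribution"

definition gauss_quantile :: "real \<Rightarrow> real" where
  "gauss_quantile = inv gauss_cdf"

text \<open>
  The Gaussian isoperimetric function: the density at the endpoint of a half-line of measure \<open>p\<close>, for
  \<open>p\<close> strictly between \<open>0\<close> and \<open>1\<close>.
\<close>

definition gauss_profile :: "real \<Rightarrow> real" where
  "gauss_profile p = std_normal_density (gauss_quantile p)"

lemma std_normal_density_pos: "0 < std_normal_density x"
  by (simp add: normal_density_def)

lemma std_normal_density_le_1: "std_normal_density x \<le> 1"
proof -
  have "1 * 1 \<le> 2 * pi"
    using pi_ge_two by (intro mult_mono) auto
  hence "1 / sqrt (2 * pi) \<le> 1"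
    by simp
  moreover have "exp (- x\<^sup>2 / 2) \<le> 1"
    by simp
  ultimately have "1 / sqrt (2 * pi) * exp (- x\<^sup>2 / 2) \<le> 1 * 1"
    by (intro mult_mono) auto
  thus ?thesis
    by (simp add: std_normal_density_def)
qed

lemma DERIV_std_normal_density:
  "(std_normal_density has_real_derivative - x * std_normal_density x) (at x)"
  unfolding std_normal_density_def
  by (auto intro!: derivative_eq_intros simp: power2_eq_square field_simps real_sqrt_mult_self)

lemma abs_mult_std_normal_density_le_1: "\<bar>x * std_normal_density x\<bar> \<le> 1"
proof -
  have "\<bar>x\<bar> \<le> 1 + x\<^sup>2 / 2"
  proof -
    have "0 \<le> (\<bar>x\<bar> - 1)\<^sup>2" by simp
    thus ?thesis by (simp add: power2_diff)
  qed
  also have "\<dots> \<le> exp (x\<^sup>2 / 2)"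
    by (rule exp_ge_add_one_self)
  finally have a: "\<bar>x\<bar> * exp (- x\<^sup>2 / 2) \<le> 1"
    by (simp add: exp_minus field_simps)
  have "1 * 1 \<le> 2 * pi"
    using pi_ge_two by (intro mult_mono) auto
  hence "1 / sqrt (2 * pi) \<le> 1"
    by simp
  hence "1 / sqrt (2 * pi) * (\<bar>x\<bar> * exp (- x\<^sup>2 / 2)) \<le> 1 * 1"
    using a by (intro mult_mono) auto
  thus ?thesis
    by (simp add: std_normal_density_def abs_mult)
qed

lemma std_normal_density_lipschitz:
  "\<bar>std_normal_density x - std_normal_density y\<bar> \<le> \<bar>x - y\<bar>"
  using field_differentiable_bound[of UNIV std_normal_density "\<lambda>x. - x * std_normal_density x" 1 x y]
    DERIV_std_normal_density abs_mult_std_normal_density_le_1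
  by (auto simp: has_field_derivative_at_within)

text \<open>
  The link between the distribution function, defined through the measure, and the fundamental theorem
  of calculus for the Henstock-Kurzweil integral.
\<close>

lemma gauss_cdf_diff:
  assumes "a \<le> b"
  shows "gauss_cdf b - gauss_cdf a = integral {a..b} std_normal_density"
proof -
  interpret real_distribution std_normal_distribution
    by (rule real_dist_normal_dist)
  have "continuous_on {a..b} std_normal_density"
    by (intro continuous_at_imp_continuous_on ballI DERIV_isCont[OF DERIV_std_normal_density])
  hence int: "set_integrable lborel {a..b} std_normal_density"
    by (rule borel_integrable_atLeastAtMost')
  have "gauss_cdf b - gauss_cdf a = measure std_normal_distribution {a<..b}"
  proof (cases "a < b")
    case True
    then show ?thesis by (simp add: gauss_cdf_def cdf_diff_eq)
  qed (use assms in auto)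
  also have "emeasure std_normal_distribution {a<..b} = (\<integral>\<^sup>+x\<in>{a<..b}. std_normal_density x \<partial>lborel)"
    by (subst emeasure_density) auto
  hence "measure std_normal_distribution {a<..b} = (LINT x:{a<..b}|lborel. std_normal_density x)"
    unfolding measure_def set_lebesgue_integral_def
    by (subst integral_eq_nn_integral)
       (auto intro!: arg_cong[where f=enn2real] nn_integral_cong simp: indicator_def)
  also have "\<dots> = (LINT x:{a..b}|lborel. std_normal_density x)"
    unfolding set_lebesgue_integral_def
    by (intro integral_cong_AE) (use AE_lborel_singleton[of a] in \<open>auto simp: indicator_def\<close>)
  also have "\<dots> = integral {a..b} std_normal_density"
    using int by (rule set_borel_integral_eq_integral)
  finally show ?thesis .
qed

lemma DERIV_gauss_cdf: "(gauss_cdf has_real_derivative std_normal_density x) (at x)"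
proof -
  have c: "continuous_on {x-1..x+1} std_normal_density"
    by (intro continuous_at_imp_continuous_on ballI DERIV_isCont[OF DERIV_std_normal_density])
  have "((\<lambda>u. integral {x-1..u} std_normal_density) has_real_derivative std_normal_density x)
      (at x within {x-1..x+1})"
    by (rule integral_has_real_derivative[OF c]) auto
  hence "((\<lambda>u. integral {x-1..u} std_normal_density + gauss_cdf (x - 1)) has_real_derivative
      std_normal_density x) (at x)"
    by (subst (asm) at_within_Icc_at) (auto intro!: derivative_eq_intros)
  moreover have "\<forall>\<^sub>F u in nhds x. u \<in> {x-1<..<x+1}"
    by (intro eventually_nhds_in_open) auto
  hence "\<forall>\<^sub>F u in nhds x. integral {x-1..u} std_normal_density + gauss_cdf (x - 1) = gauss_cdf u"
  proof eventually_elim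
    case (elim u)
    thus ?case using gauss_cdf_diff[of "x - 1" u] by simp
  qed
  ultimately show ?thesis
    by (rule DERIV_cong_ev[THEN iffD1, rotated -1, OF _ refl _ refl])
qed

lemma isCont_gauss_cdf: "isCont gauss_cdf x"
  by (rule DERIV_isCont[OF DERIV_gauss_cdf])

lemma strict_mono_gauss_cdf: "strict_mono gauss_cdf"
proof (rule strict_monoI)
  fix x y :: real assume "x < y"
  thus "gauss_cdf x < gauss_cdf y"
    by (rule DERIV_pos_imp_increasing) (use DERIV_gauss_cdf std_normal_density_pos in blast)
qed

lemmas gauss_cdf_less_iff = strict_mono_less[OF strict_mono_gauss_cdf]
lemmas gauss_cdf_le_iff = strict_mono_less_eq[OF strict_mono_gauss_cdf]

lemma gauss_cdf_at_bot: "(gauss_cdf \<longlongrightarrow> 0) at_bot"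
  and gauss_cdf_at_top: "(gauss_cdf \<longlongrightarrow> 1) at_top"
proof -
  interpret real_distribution std_normal_distribution
    by (rule real_dist_normal_dist)
  show "(gauss_cdf \<longlongrightarrow> 0) at_bot" "(gauss_cdf \<longlongrightarrow> 1) at_top"
    unfolding gauss_cdf_def by (rule cdf_lim_at_bot cdf_lim_at_top_prob)+
qed

lemma gauss_cdf_bounds: "0 < gauss_cdf x" "gauss_cdf x < 1"
proof -
  interpret real_distribution std_normal_distribution
    by (rule real_dist_normal_dist)
  have "0 \<le> gauss_cdf (x - 1)" "gauss_cdf (x + 1) \<le> 1"
    by (simp_all add: gauss_cdf_def cdf_nonneg cdf_bounded_prob)
  moreover have "gauss_cdf (x - 1) < gauss_cdf x" "gauss_cdf x < gauss_cdf (x + 1)"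
    by (simp_all add: gauss_cdf_less_iff)
  ultimately show "0 < gauss_cdf x" "gauss_cdf x < 1"
    by linarith+
qed

lemma range_gauss_cdf: "range gauss_cdf = {0<..<1}"
proof (intro equalityI subsetI)
  fix p :: real assume p: "p \<in> {0<..<1}"
  have "\<forall>\<^sub>F x in at_bot. gauss_cdf x < p"
    using order_tendstoD(2)[OF gauss_cdf_at_bot] p by auto
  then obtain a where a: "gauss_cdf a < p"
    using eventually_happens' trivial_limit_at_bot_linorder by blast
  have "\<forall>\<^sub>F x in at_top. p < gauss_cdf x"
    using order_tendstoD(1)[OF gauss_cdf_at_top] p by auto
  then obtain b where b: "p < gauss_cdf b"
    using eventually_happens' trivial_limit_at_top_linorder by blast
  have "a \<le> b"
    using a b gauss_cdf_less_iff[of a b] by linarith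
  then obtain x where "gauss_cdf x = p"
    using IVT[of gauss_cdf a p b] a b isCont_gauss_cdf by auto
  thus "p \<in> range gauss_cdf" by auto
qed (use gauss_cdf_bounds in auto)

lemma gauss_quantile_cdf: "gauss_quantile (gauss_cdf x) = x"
  unfolding gauss_quantile_def by (simp add: strict_mono_imp_inj_on[OF strict_mono_gauss_cdf])

lemma gauss_cdf_quantile: "0 < p \<Longrightarrow> p < 1 \<Longrightarrow> gauss_cdf (gauss_quantile p) = p"
  unfolding gauss_quantile_def by (rule f_inv_into_f) (simp add: range_gauss_cdf)

lemma gauss_profile_cdf: "gauss_profile (gauss_cdf x) = std_normal_density x"
  by (simp add: gauss_profile_def gauss_quantile_cdf)

lemma gauss_profile_pos: "0 < gauss_profile p"
  by (simp add: gauss_profile_def std_normal_density_pos)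

lemma gauss_profile_le_1: "gauss_profile p \<le> 1"
  by (simp add: gauss_profile_def std_normal_density_le_1)

lemma DERIV_gauss_quantile:
  assumes "0 < p" "p < 1"
  shows "(gauss_quantile has_real_derivative 1 / gauss_profile p) (at p)"
proof -
  obtain x where x: "p = gauss_cdf x"
    using range_gauss_cdf assms by (metis greaterThanLessThan_iff imageE)
  have "(gauss_quantile has_real_derivative inverse (std_normal_density x)) (at p)"
  proof (rule DERIV_inverse_function[where f=gauss_cdf and a=0 and b=1])
    show "(gauss_cdf has_real_derivative std_normal_density x) (at (gauss_quantile p))"
      by (simp add: x gauss_quantile_cdf DERIV_gauss_cdf)
    show "isCont gauss_quantile p"
      unfolding x
      by (rule isCont_inverse_function[where d=1])
         (auto simp: gauss_quantile_cdf isCont_gauss_cdf)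
  qed (use assms std_normal_density_pos[of x] gauss_cdf_quantile in auto)
  thus ?thesis
    by (simp add: x gauss_profile_cdf inverse_eq_divide)
qed

text \<open>
  Differentiating once more with \<open>DERIV_gauss_quantile\<close> gives \<open>I'' = - 1 / I\<close>, the differential equation
  on which the whole argument rests.
\<close>

lemma DERIV_gauss_profile:
  assumes "0 < p" "p < 1"
  shows "(gauss_profile has_real_derivative - gauss_quantile p) (at p)"
proof -
  have "((\<lambda>p. std_normal_density (gauss_quantile p)) has_real_derivative
      (- gauss_quantile p * std_normal_density (gauss_quantile p)) * (1 / gauss_profile p)) (at p)"
    by (rule DERIV_chain2[OF DERIV_std_normal_density DERIV_gauss_quantile[OF assms]])
  thus ?thesis
    using gauss_profile_pos[of p] by (simp add: gauss_profile_def[abs_def])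
qed

lemma isCont_gauss_profile: "0 < p \<Longrightarrow> p < 1 \<Longrightarrow> isCont gauss_profile p"
  by (rule DERIV_isCont[OF DERIV_gauss_profile])

section \<open>Averages over finite sets\<close>

definition avg :: "'c set \<Rightarrow> ('c \<Rightarrow> real) \<Rightarrow> real" where
  "avg A h = (\<Sum>a\<in>A. h a) / real (card A)"

definition variance_on :: "'c set \<Rightarrow> ('c \<Rightarrow> real) \<Rightarrow> real" where
  "variance_on A h = avg A (\<lambda>a. (h a - avg A h)\<^sup>2)"

lemma avg_add: "avg A (\<lambda>a. g a + h a) = avg A g + avg A h"
  by (simp add: avg_def sum.distrib add_divide_distrib)

lemma avg_diff: "avg A (\<lambda>a. g a - h a) = avg A g - avg A h"
  by (simp add: avg_def sum_subtractf diff_divide_distrib)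

lemma avg_cmult: "avg A (\<lambda>a. c * h a) = c * avg A h"
  by (simp add: avg_def sum_distrib_left)

lemma avg_const: "finite A \<Longrightarrow> A \<noteq> {} \<Longrightarrow> avg A (\<lambda>a. c) = c"
  by (simp add: avg_def)

lemma avg_cong: "(\<And>a. a \<in> A \<Longrightarrow> g a = h a) \<Longrightarrow> avg A g = avg A h"
  by (simp add: avg_def)

lemma avg_mono: "(\<And>a. a \<in> A \<Longrightarrow> g a \<le> h a) \<Longrightarrow> avg A g \<le> avg A h"
  unfolding avg_def by (intro divide_right_mono sum_mono) auto

lemma avg_nonneg: "(\<And>a. a \<in> A \<Longrightarrow> 0 \<le> h a) \<Longrightarrow> 0 \<le> avg A h"
  unfolding avg_def by (intro divide_nonneg_nonneg sum_nonneg) auto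

lemma avg_between:
  assumes "finite A" "A \<noteq> {}" "\<And>a. a \<in> A \<Longrightarrow> h a \<in> {lo..hi}"
  shows "avg A h \<in> {lo..hi}"
  using avg_mono[of A "\<lambda>_. lo" h] avg_mono[of A h "\<lambda>_. hi"] assms by (auto simp: avg_const)

lemma abs_avg_le: "\<bar>avg A h\<bar> \<le> avg A (\<lambda>a. \<bar>h a\<bar>)"
  unfolding avg_def by (simp add: abs_divide divide_right_mono sum_abs)

lemma variance_on_nonneg: "0 \<le> variance_on A h"
  unfolding variance_on_def by (rule avg_nonneg) simp

text \<open>
  Written with pairs, the variance is monotone in the distances between the values, which makes it
  comparable for different functions without reference to their means.
\<close>

lemma variance_on_pairs:
  assumes "finite A" "A \<noteq> {}"
  shows "variance_on A h = avg A (\<lambda>a. avg A (\<lambda>b. (h a - h b)\<^sup>2)) / 2"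
proof -
  let ?m = "avg A h" and ?q = "avg A (\<lambda>a. (h a)\<^sup>2)"
  have "variance_on A h = avg A (\<lambda>a. (h a)\<^sup>2 + (?m\<^sup>2 - (2 * ?m) * h a))"
    unfolding variance_on_def by (intro avg_cong) (simp add: power2_diff algebra_simps)
  also have "\<dots> = ?q - ?m\<^sup>2"
    by (simp add: avg_add avg_diff avg_cmult avg_const assms power2_eq_square)
  finally have v: "variance_on A h = ?q - ?m\<^sup>2" .
  have "avg A (\<lambda>b. (h a - h b)\<^sup>2) = (h a)\<^sup>2 + (?q - (2 * ?m) * h a)" for a
  proof -
    have "avg A (\<lambda>b. (h a - h b)\<^sup>2) = avg A (\<lambda>b. (h a)\<^sup>2 + ((h b)\<^sup>2 - (2 * h a) * h b))"
      by (intro avg_cong) (simp add: power2_diff algebra_simps)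
    also have "\<dots> = (h a)\<^sup>2 + (?q - (2 * h a) * ?m)"
      by (simp only: avg_add avg_diff avg_cmult avg_const[OF assms])
    finally show ?thesis by simp
  qed
  hence "avg A (\<lambda>a. avg A (\<lambda>b. (h a - h b)\<^sup>2)) = avg A (\<lambda>a. (h a)\<^sup>2 + (?q - (2 * ?m) * h a))"
    by simp
  also have "\<dots> = ?q + (?q - (2 * ?m) * ?m)"
    by (simp only: avg_add avg_diff avg_cmult avg_const[OF assms])
  finally show ?thesis
    by (simp add: v power2_eq_square)
qed

lemma variance_on_le_square:
  assumes "finite A" "A \<noteq> {}" "\<And>a b. a \<in> A \<Longrightarrow> b \<in> A \<Longrightarrow> \<bar>h a - h b\<bar> \<le> t"
  shows "variance_on A h \<le> t\<^sup>2"
proof -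
  have sq: "(h a - h b)\<^sup>2 \<le> t\<^sup>2" if "a \<in> A" "b \<in> A" for a b
    using assms(3)[OF that] by (simp add: abs_le_square_iff[symmetric])
  have "avg A (\<lambda>a. avg A (\<lambda>b. (h a - h b)\<^sup>2)) \<le> avg A (\<lambda>a. avg A (\<lambda>b. t\<^sup>2))"
    by (intro avg_mono sq)
  also have "\<dots> = t\<^sup>2"
    by (simp add: avg_const assms)
  finally show ?thesis
    using variance_on_pairs[OF assms(1,2), of h] zero_le_power2[of t] by linarith
qed

text \<open>
  The triangle inequality for the norm of the complex numbers \<open>g a + \<i> h a\<close>.
\<close>

lemma avg_sqrt_minkowski:
  "sqrt ((avg A g)\<^sup>2 + (avg A h)\<^sup>2) \<le> avg A (\<lambda>a. sqrt ((g a)\<^sup>2 + (h a)\<^sup>2))"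
proof -
  have "cmod (\<Sum>a\<in>A. Complex (g a) (h a)) \<le> (\<Sum>a\<in>A. cmod (Complex (g a) (h a)))"
    by (rule norm_sum)
  moreover have "(\<Sum>a\<in>A. Complex (g a) (h a)) = Complex (\<Sum>a\<in>A. g a) (\<Sum>a\<in>A. h a)"
    by (simp add: complex_eq_iff)
  ultimately have *: "sqrt ((\<Sum>a\<in>A. g a)\<^sup>2 + (\<Sum>a\<in>A. h a)\<^sup>2) \<le> (\<Sum>a\<in>A. sqrt ((g a)\<^sup>2 + (h a)\<^sup>2))"
    by (simp add: complex_norm)
  have "sqrt ((avg A g)\<^sup>2 + (avg A h)\<^sup>2)
      = sqrt (((\<Sum>a\<in>A. g a)\<^sup>2 + (\<Sum>a\<in>A. h a)\<^sup>2) / (real (card A))\<^sup>2)"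
    by (simp add: avg_def power_divide add_divide_distrib)
  also have "\<dots> = sqrt ((\<Sum>a\<in>A. g a)\<^sup>2 + (\<Sum>a\<in>A. h a)\<^sup>2) / real (card A)"
    by (simp add: real_sqrt_divide)
  also have "\<dots> \<le> avg A (\<lambda>a. sqrt ((g a)\<^sup>2 + (h a)\<^sup>2))"
    unfolding avg_def by (rule divide_right_mono[OF *]) simp
  finally show ?thesis .
qed

lemma avg_PiE_Suc:
  fixes V :: "nat \<Rightarrow> 'c set"
  assumes "\<And>i. i \<in> {1..Suc n} \<Longrightarrow> finite (V i)"
  shows "avg (PiE {1..Suc n} V) u = avg (V (Suc n)) (\<lambda>a. avg (PiE {1..n} V) (\<lambda>x. u (x(Suc n := a))))"
proof -
  have eq: "{1..Suc n} = insert (Suc n) {1..n}" by auto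
  have inj: "inj_on (\<lambda>(a, x). x(Suc n := a)) (V (Suc n) \<times> PiE {1..n} V)"
    by (rule inj_combinator) simp
  have im: "PiE {1..Suc n} V = (\<lambda>(a, x). x(Suc n := a)) ` (V (Suc n) \<times> PiE {1..n} V)"
    unfolding eq by (rule PiE_insert_eq)
  have card: "card (PiE {1..Suc n} V) = card (V (Suc n)) * card (PiE {1..n} V)"
    unfolding im card_image[OF inj] card_cartesian_product ..
  have "(\<Sum>x\<in>PiE {1..Suc n} V. u x) = (\<Sum>a\<in>V (Suc n). \<Sum>x\<in>PiE {1..n} V. u (x(Suc n := a)))"
    unfolding im by (subst sum.reindex[OF inj]) (simp add: sum.cartesian_product case_prod_unfold)
  thus ?thesis
    unfolding avg_def card by (simp add: sum_divide_distrib[symmetric] mult.commute)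
qed

section \<open>A one-coordinate inequality for the Gaussian profile\<close>

lemma sqrt_add_ge_taylor:
  assumes "0 < (r::real)" "0 \<le> v"
  shows "r + v / (2 * r) - v\<^sup>2 / (8 * r ^ 3) \<le> sqrt (r\<^sup>2 + v)"
proof -
  define x where "x = v / r\<^sup>2"
  have x0: "0 \<le> x" using assms by (simp add: x_def)
  have "1 + x / 2 - x\<^sup>2 / 8 \<le> sqrt (1 + x)"
  proof (cases "x \<le> 8")
    case True
    have "(1 + x / 2 - x\<^sup>2 / 8)\<^sup>2 = 1 + x - x ^ 3 / 8 * (1 - x / 8)"
      by (simp add: power2_eq_square power3_eq_cube field_simps)
    also have "\<dots> \<le> 1 + x"
      using True x0 by simp
    finally show ?thesis
      by (rule real_le_rsqrt)
  next
    case False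
    have "x * 8 \<le> x * x" using False by (intro mult_left_mono) auto
    hence "1 + x / 2 - x\<^sup>2 / 8 \<le> 1 + x / 2 - x"
      by (simp add: power2_eq_square)
    also have "\<dots> \<le> 0" using False by simp
    also have "0 \<le> sqrt (1 + x)" using x0 by simp
    finally show ?thesis .
  qed
  hence "r * (1 + x / 2 - x\<^sup>2 / 8) \<le> r * sqrt (1 + x)"
    using assms by (intro mult_left_mono) auto
  also have "r * sqrt (1 + x) = sqrt (r\<^sup>2 * (1 + x))"
    using assms by (simp add: real_sqrt_mult)
  also have "r\<^sup>2 * (1 + x) = r\<^sup>2 + v"
    using assms by (simp add: x_def field_simps)
  also have "r * (1 + x / 2 - x\<^sup>2 / 8) = r + v / (2 * r) - v\<^sup>2 / (8 * r ^ 3)"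
    using assms by (simp add: x_def field_simps power2_eq_square power3_eq_cube)
  finally show ?thesis .
qed

text \<open>
  Taylor's formula of order two: the second derivative of the profile is \<open>- 1 / gauss_profile\<close>.
\<close>

lemma gauss_profile_taylor:
  assumes "m \<in> {0<..<1}" "y \<in> {0<..<1}"
    and "\<And>z. z \<in> closed_segment m y \<Longrightarrow> 1 / gauss_profile z \<le> K"
  shows "gauss_profile m - gauss_quantile m * (y - m) - K / 2 * (y - m)\<^sup>2 \<le> gauss_profile y"
proof (cases "y = m")
  case False
  \<comment> \<open>The successive derivatives of the profile.\<close>
  define diff where "diff = (\<lambda>j::nat. if j = 0 then gauss_profile else if j = 1 then (\<lambda>p. - gauss_quantile p)
      else (\<lambda>p. - (1 / gauss_profile p)))"
  have seg: "z \<in> {0<..<1}" if "min m y \<le> z" "z \<le> max m y" for z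
    using that assms(1,2) by auto
  have "\<exists>t. (if y < m then y < t \<and> t < m else m < t \<and> t < y) \<and>
      gauss_profile y = (\<Sum>j<2. (diff j m / fact j) * (y - m) ^ j) + (diff 2 t / fact 2) * (y - m) ^ 2"
  proof (rule Taylor[where a="min m y" and b="max m y"])
    show "\<forall>j t. j < 2 \<and> min m y \<le> t \<and> t \<le> max m y \<longrightarrow> DERIV (diff j) t :> diff (Suc j) t"
    proof (intro allI impI, elim conjE)
      fix j :: nat and t assume "j < 2" and t: "min m y \<le> t" "t \<le> max m y"
      then consider "j = 0" | "j = 1" by linarith
      thus "DERIV (diff j) t :> diff (Suc j) t"
        using seg[OF t] DERIV_gauss_profile[of t] DERIV_minus[OF DERIV_gauss_quantile[of t]]
        by cases (auto simp: diff_def)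
    qed
  qed (use False in \<open>auto simp: diff_def\<close>)
  then obtain t where t': "if y < m then y < t \<and> t < m else m < t \<and> t < y" and
    eq': "gauss_profile y = (\<Sum>j<2. (diff j m / fact j) * (y - m) ^ j) + (diff 2 t / fact 2) * (y - m) ^ 2"
    by blast
  have t: "t \<in> closed_segment m y"
    using t' by (auto simp: closed_segment_eq_real_ivl split: if_splits)
  have eq: "gauss_profile y = gauss_profile m - gauss_quantile m * (y - m) - 1 / gauss_profile t / 2 * (y - m)\<^sup>2"
    unfolding eq' by (simp add: diff_def lessThan_nat_numeral lessThan_Suc)
  have "1 / gauss_profile t / 2 * (y - m)\<^sup>2 \<le> K / 2 * (y - m)\<^sup>2"
    using assms(3)[OF t] by (intro mult_right_mono divide_right_mono) auto
  thus ?thesis by (simp add: eq)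
qed simp

text \<open>
  With \<open>m = E h\<close> and \<open>V = Var h\<close>, the mean of \<open>I(h)\<close> is \<open>I(m) - V / (2 I(m))\<close> to second order, because
  \<open>I'' = - 1 / I\<close>; replacing \<open>I(h)\<close> by \<open>sqrt (I(h)\<^sup>2 + V)\<close> adds \<open>V / (2 I(h))\<close> to first order. The two
  corrections cancel except for the variation of \<open>1 / I\<close> over the range of \<open>h\<close>, which is small by uniform
  continuity when the values stay in a compact subinterval of \<open>(0, 1)\<close>. An error proportional to \<open>t\<^sup>2\<close> with an
  arbitrarily small factor is good enough for a product of \<open>n\<close> factors with \<open>t\<close> of order \<open>1 / sqrt n\<close>.
\<close>

lemma gauss_profile_one_step:
  assumes eta: "0 < lo" "hi < 1" and kappa: "0 < \<kappa>"
  obtains \<delta> where "0 < \<delta>"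
    "\<And>(A::'c set) h t. finite A \<Longrightarrow> A \<noteq> {} \<Longrightarrow> h ` A \<subseteq> {lo..hi} \<Longrightarrow>
       (\<And>a b. a \<in> A \<Longrightarrow> b \<in> A \<Longrightarrow> \<bar>h a - h b\<bar> \<le> t) \<Longrightarrow> t \<le> \<delta> \<Longrightarrow>
       gauss_profile (avg A h) \<le> avg A (\<lambda>a. sqrt ((gauss_profile (h a))\<^sup>2 + variance_on A h)) + \<kappa> * t\<^sup>2"
proof -
  define J where "J = (\<lambda>p. 1 / gauss_profile p)"
  define e where "e = \<kappa> / 2"
  have e: "0 < e" using kappa by (simp add: e_def)
  have contJ: "continuous_on {lo..hi} J"
    unfolding J_def using eta gauss_profile_pos
    by (intro continuous_at_imp_continuous_on ballI continuous_intros isCont_gauss_profile)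
       (auto simp: less_imp_neq[symmetric])
  have "uniformly_continuous_on {lo..hi} J"
    by (rule compact_uniformly_continuous[OF contJ]) simp
  then obtain d1 where d1: "0 < d1"
    "\<And>x y. x \<in> {lo..hi} \<Longrightarrow> y \<in> {lo..hi} \<Longrightarrow> \<bar>x - y\<bar> < d1 \<Longrightarrow> \<bar>J x - J y\<bar> < e"
    using e unfolding uniformly_continuous_on_def dist_real_def by meson
  have "bounded (J ` {lo..hi})"
    by (intro compact_imp_bounded compact_continuous_image contJ) simp
  then obtain M where "0 < M" "\<forall>y\<in>J ` {lo..hi}. \<bar>y\<bar> \<le> M"
    unfolding bounded_pos by auto
  hence M: "0 < M" "\<And>x. x \<in> {lo..hi} \<Longrightarrow> J x \<le> M"
    using abs_le_D1 by blast+
  have Jpos: "0 < J x" for x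
    using gauss_profile_pos[of x] by (simp add: J_def)
  \<comment> \<open>The first bound keeps \<open>J\<close> within \<open>e\<close> of its value at the mean; the second makes the
    quartic term of the expansion of the square root at most \<open>e * V\<close>.\<close>
  define \<delta> where "\<delta> = min (d1 / 2) (sqrt (8 * e / M ^ 3))"
  have d0: "0 < \<delta>"
    using d1(1) e M(1) by (simp add: \<delta>_def)
  show thesis
  proof (rule that[OF d0])
    fix A :: "'c set" and h t
    assume A: "finite A" "A \<noteq> {}" "h ` A \<subseteq> {lo..hi}"
      and osc: "\<And>a b. a \<in> A \<Longrightarrow> b \<in> A \<Longrightarrow> \<bar>h a - h b\<bar> \<le> t" and t: "t \<le> \<delta>"
    define m where "m = avg A h"
    define V where "V = variance_on A h"
    have m: "m \<in> {lo..hi}"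
      unfolding m_def using A by (intro avg_between) auto
    have t0: "0 \<le> t" using osc A(2) by force
    have V: "0 \<le> V" "V \<le> t\<^sup>2"
      unfolding V_def using variance_on_nonneg variance_on_le_square[OF A(1,2) osc] by auto
    have "t \<le> sqrt (8 * e / M ^ 3)" using t by (simp add: \<delta>_def)
    hence "t\<^sup>2 \<le> (sqrt (8 * e / M ^ 3))\<^sup>2" using t0 by (intro power_mono) auto
    hence tM: "t\<^sup>2 * M ^ 3 \<le> 8 * e" using M(1) e by (simp add: field_simps)
    have near: "\<bar>h a - m\<bar> \<le> t" if a: "a \<in> A" for a
    proof -
      have "h a - m = avg A (\<lambda>b. h a - h b)"
        by (simp add: avg_diff avg_const A m_def)
      also have "\<bar>\<dots>\<bar> \<le> avg A (\<lambda>b. \<bar>h a - h b\<bar>)" by (rule abs_avg_le)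
      also have "\<dots> \<le> avg A (\<lambda>b. t)" by (intro avg_mono osc a)
      finally show ?thesis by (simp add: avg_const A)
    qed
    have ptw: "gauss_profile m - gauss_quantile m * (h a - m) - (J m + e) / 2 * (h a - m)\<^sup>2
        + (V / 2 * (J m - e) - e * V) \<le> sqrt ((gauss_profile (h a))\<^sup>2 + V)" if a: "a \<in> A" for a
    proof -
      have ha: "h a \<in> {lo..hi}" using A a by auto
      have close: "\<bar>J z - J m\<bar> < e" if z: "z \<in> closed_segment m (h a)" for z
      proof (rule d1(2)[OF _ m])
        show "z \<in> {lo..hi}" using z m ha by (auto simp: closed_segment_eq_real_ivl split: if_splits)
        have "\<bar>z - m\<bar> \<le> \<bar>h a - m\<bar>" using z by (auto simp: closed_segment_eq_real_ivl split: if_splits)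
        also have "\<dots> \<le> d1 / 2" using near[OF a] t by (simp add: \<delta>_def)
        finally show "\<bar>z - m\<bar> < d1" using d1(1) by linarith
      qed
      have 1: "gauss_profile m - gauss_quantile m * (h a - m) - (J m + e) / 2 * (h a - m)\<^sup>2 \<le> gauss_profile (h a)"
      proof (rule gauss_profile_taylor)
        show "1 / gauss_profile z \<le> J m + e" if "z \<in> closed_segment m (h a)" for z
          using close[OF that] by (simp add: J_def)
      qed (use m ha eta in auto)
      have "V / 2 * (J m - e) \<le> V / 2 * J (h a)"
        using close[of "h a"] V by (intro mult_left_mono) auto
      hence 2: "V / 2 * (J m - e) \<le> V / (2 * gauss_profile (h a))"
        by (simp add: J_def)
      have "V\<^sup>2 / (8 * gauss_profile (h a) ^ 3) = V * (V * J (h a) ^ 3 / 8)"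
        by (simp add: J_def power2_eq_square power_divide)
      also have "\<dots> \<le> V * (t\<^sup>2 * M ^ 3 / 8)"
        using V M ha Jpos[of "h a"] by (intro mult_left_mono divide_right_mono mult_mono power_mono) auto
      also have "\<dots> \<le> V * e"
        using tM V by (intro mult_left_mono) auto
      finally have 3: "V\<^sup>2 / (8 * gauss_profile (h a) ^ 3) \<le> e * V" by (simp add: mult.commute)
      show ?thesis
        using 1 2 3 sqrt_add_ge_taylor[OF gauss_profile_pos V(1), of "h a"] by linarith
    qed
    have "gauss_profile m - \<kappa> * V = gauss_profile m - gauss_quantile m * (avg A h - m)
        - (J m + e) / 2 * V + (V / 2 * (J m - e) - e * V)"
      by (simp add: m_def[symmetric] e_def field_simps)
    also have "\<dots> = avg A (\<lambda>a. gauss_profile m - gauss_quantile m * (h a - m)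
        - (J m + e) / 2 * (h a - m)\<^sup>2 + (V / 2 * (J m - e) - e * V))"
      by (simp only: avg_add avg_diff avg_cmult avg_const[OF A(1,2)] V_def variance_on_def m_def)
    also have "\<dots> \<le> avg A (\<lambda>a. sqrt ((gauss_profile (h a))\<^sup>2 + V))"
      by (intro avg_mono ptw)
    finally have "gauss_profile m - \<kappa> * V \<le> avg A (\<lambda>a. sqrt ((gauss_profile (h a))\<^sup>2 + V))" .
    moreover have "\<kappa> * V \<le> \<kappa> * t\<^sup>2"
      using V kappa by (intro mult_left_mono) auto
    ultimately show "gauss_profile (avg A h)
        \<le> avg A (\<lambda>a. sqrt ((gauss_profile (h a))\<^sup>2 + variance_on A h)) + \<kappa> * t\<^sup>2"
      by (simp add: m_def V_def)
  qed
qed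

section \<open>Variance of Lipschitz functions on a connected graph\<close>

text \<open>
  Connectedness of a graph in the form in which it bounds gaps between sorted values: every nontrivial
  vertex set is left by some edge. The edges are given by an arbitrary relation.
\<close>

definition cut_connected :: "'c set \<Rightarrow> ('c \<Rightarrow> 'c \<Rightarrow> bool) \<Rightarrow> bool" where
  "cut_connected V R \<longleftrightarrow> (\<forall>S. S \<subset> V \<longrightarrow> S \<noteq> {} \<longrightarrow> (\<exists>a\<in>S. \<exists>b\<in>V - S. R a b))"

lemma finite_enumerate_by_key:
  fixes w :: "'c \<Rightarrow> real"
  assumes "finite V"
  obtains e where "bij_betw e {..<card V} V" "\<And>i j. i \<le> j \<Longrightarrow> j < card V \<Longrightarrow> w (e i) \<le> w (e j)"
proof -
  obtain xs where xs: "set xs = V" "distinct xs"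
    using finite_distinct_list[OF assms] by blast
  define l where "l = sort_key w xs"
  have l: "set l = V" "distinct l" "sorted (map w l)"
    using xs by (simp_all add: l_def)
  have len: "length l = card V"
    using l distinct_card by fastforce
  show thesis
  proof (rule that[of "(!) l"])
    show "bij_betw ((!) l) {..<card V} V"
      using l len by (intro bij_betw_nth) auto
    show "w (l ! i) \<le> w (l ! j)" if "i \<le> j" "j < card V" for i j
      using sorted_nth_mono[OF l(3), of i j] that len by simp
  qed
qed

text \<open>
  After sorting the vertices by their values, some edge leads from the first \<open>j + 1\<close> vertices to the
  remaining ones; its increment is at least the gap between the values number \<open>j\<close> and \<open>j + 1\<close>, so that this
  gap is at most \<open>L\<close>. Thus every connected graph is compared with the path.
\<close>

lemma cut_connected_enumeration_lipschitz:
  fixes w :: "'c \<Rightarrow> real"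
  assumes fin: "finite V" and conn: "cut_connected V R"
    and lip: "\<And>a b. a \<in> V \<Longrightarrow> b \<in> V \<Longrightarrow> R a b \<Longrightarrow> \<bar>w a - w b\<bar> \<le> L"
  obtains e where "bij_betw e {..<card V} V"
    "\<And>i j. i < card V \<Longrightarrow> j < card V \<Longrightarrow> \<bar>w (e i) - w (e j)\<bar> \<le> L * \<bar>real i - real j\<bar>"
proof -
  obtain e where e: "bij_betw e {..<card V} V"
    and mono: "\<And>i j. i \<le> j \<Longrightarrow> j < card V \<Longrightarrow> w (e i) \<le> w (e j)"
    using finite_enumerate_by_key[OF fin] by blast
  have gap: "w (e (Suc j)) - w (e j) \<le> L" if j: "Suc j < card V" for j
  proof -
    define S where "S = e ` {..j}"
    have sub: "S \<subseteq> V" using e j by (auto simp: S_def bij_betw_def)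
    have "e (Suc j) \<in> V" using e j by (auto simp: bij_betw_def)
    moreover have "e (Suc j) \<notin> S"
      using e j unfolding S_def bij_betw_def inj_on_def by fastforce
    ultimately have "S \<subset> V" using sub by auto
    moreover have "S \<noteq> {}" by (auto simp: S_def)
    ultimately obtain a b where ab: "a \<in> S" "b \<in> V - S" "R a b"
      using conn unfolding cut_connected_def by meson
    obtain i where i: "i \<le> j" "a = e i" using ab by (auto simp: S_def)
    obtain i' where i': "i' < card V" "b = e i'" using ab e by (auto simp: bij_betw_def)
    have "j < i'" using ab(2) i' by (force simp: S_def not_le)
    hence "w (e (Suc j)) \<le> w b" using mono i' by simp
    moreover have "w a \<le> w (e j)" using mono i j by simp
    moreover have "w b - w a \<le> L" using lip[of a b] ab sub by auto
    ultimately show ?thesis by linarith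
  qed
  have up: "w (e j) - w (e i) \<le> L * (real j - real i)" if "i \<le> j" "j < card V" for i j
    using that
  proof (induction j rule: dec_induct)
    case (step j)
    show ?case using step.IH step.prems gap[OF step.prems] by (simp add: algebra_simps)
  qed simp
  show thesis
  proof (rule that[OF e])
    fix i j assume ij: "i < card V" "j < card V"
    show "\<bar>w (e i) - w (e j)\<bar> \<le> L * \<bar>real i - real j\<bar>"
    proof (cases "i \<le> j")
      case True
      thus ?thesis using up[of i j] mono[of i j] ij by simp
    next
      case False
      thus ?thesis using up[of j i] mono[of j i] ij by simp
    qed
  qed
qed

lemma sum_sq_differences:
  "(\<Sum>i<k. \<Sum>j<k. (real i - real j)\<^sup>2) = (real k)\<^sup>2 * ((real k)\<^sup>2 - 1) / 6"
proof -
  have s1: "(\<Sum>i<k. real i) = real k * (real k - 1) / 2"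
    by (induction k) (auto simp: field_simps)
  have s2: "(\<Sum>i<k. (real i)\<^sup>2) = real k * (real k - 1) * (2 * real k - 1) / 6"
    by (induction k) (auto simp: field_simps power2_eq_square)
  have "(\<Sum>i<k. \<Sum>j<k. (real i - real j)\<^sup>2)
      = (\<Sum>i<k. real k * (real i)\<^sup>2 + (\<Sum>j<k. (real j)\<^sup>2) - 2 * real i * (\<Sum>j<k. real j))"
    by (simp add: power2_diff sum.distrib sum_subtractf sum_distrib_left mult.assoc)
  also have "\<dots> = 2 * real k * (\<Sum>i<k. (real i)\<^sup>2) - 2 * (\<Sum>i<k. real i) * (\<Sum>j<k. real j)"
    by (simp add: sum.distrib sum_subtractf sum_distrib_left[symmetric] sum_distrib_right[symmetric])
  also have "\<dots> = (real k)\<^sup>2 * ((real k)\<^sup>2 - 1) / 6"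
    unfolding s1 s2 by (simp add: field_simps power2_eq_square)
  finally show ?thesis .
qed

text \<open>
  The bound is attained by the path: \<open>(k\<^sup>2 - 1) / 12\<close> is the variance of the uniform distribution on \<open>k\<close>
  consecutive integers.
\<close>

lemma variance_on_cut_connected:
  assumes fin: "finite V" and ne: "V \<noteq> {}" and conn: "cut_connected V R"
    and lip: "\<And>a b. a \<in> V \<Longrightarrow> b \<in> V \<Longrightarrow> R a b \<Longrightarrow> \<bar>w a - w b\<bar> \<le> L"
  shows "variance_on V w \<le> L\<^sup>2 * (((real (card V))\<^sup>2 - 1) / 12)"
proof -
  obtain e where e: "bij_betw e {..<card V} V"
    and le: "\<And>i j. i < card V \<Longrightarrow> j < card V \<Longrightarrow> \<bar>w (e i) - w (e j)\<bar> \<le> L * \<bar>real i - real j\<bar>"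
    using cut_connected_enumeration_lipschitz[of V R w L] fin conn lip by blast
  define k where "k = card V"
  have k: "0 < real k" using fin ne by (simp add: k_def card_gt_0_iff)
  have sq: "(w (e i) - w (e j))\<^sup>2 \<le> L\<^sup>2 * (real i - real j)\<^sup>2" if "i < k" "j < k" for i j
  proof -
    have "\<bar>w (e i) - w (e j)\<bar>\<^sup>2 \<le> (L * \<bar>real i - real j\<bar>)\<^sup>2"
      using le[of i j] that by (intro power_mono) (auto simp: k_def)
    thus ?thesis by (simp add: power_mult_distrib)
  qed
  have "(\<Sum>a\<in>V. \<Sum>b\<in>V. (w a - w b)\<^sup>2) = (\<Sum>i<k. \<Sum>j<k. (w (e i) - w (e j))\<^sup>2)"
    unfolding k_def by (simp add: sum.reindex_bij_betw[OF e, symmetric])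
  also have "\<dots> \<le> (\<Sum>i<k. \<Sum>j<k. L\<^sup>2 * (real i - real j)\<^sup>2)"
    by (intro sum_mono sq) auto
  also have "\<dots> = L\<^sup>2 * ((real k)\<^sup>2 * ((real k)\<^sup>2 - 1) / 6)"
    by (simp add: sum_distrib_left[symmetric] sum_sq_differences)
  finally have le': "(\<Sum>a\<in>V. \<Sum>b\<in>V. (w a - w b)\<^sup>2) \<le> L\<^sup>2 * ((real k)\<^sup>2 * ((real k)\<^sup>2 - 1) / 6)" .
  have "variance_on V w = (\<Sum>a\<in>V. \<Sum>b\<in>V. (w a - w b)\<^sup>2) / (real k)\<^sup>2 / 2"
    by (simp add: variance_on_pairs[OF fin ne] avg_def k_def sum_divide_distrib[symmetric] power2_eq_square)
  also have "\<dots> \<le> L\<^sup>2 * ((real k)\<^sup>2 * ((real k)\<^sup>2 - 1) / 6) / (real k)\<^sup>2 / 2"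
    by (intro divide_right_mono le') auto
  also have "\<dots> = L\<^sup>2 * (((real k)\<^sup>2 - 1) / 12)"
    using k by simp
  finally show ?thesis by (simp add: k_def)
qed

lemma oscillation_cut_connected:
  fixes w :: "'c \<Rightarrow> real"
  assumes fin: "finite V" and conn: "cut_connected V R" and L: "0 \<le> L"
    and lip: "\<And>a b. a \<in> V \<Longrightarrow> b \<in> V \<Longrightarrow> R a b \<Longrightarrow> \<bar>w a - w b\<bar> \<le> L"
    and ab: "a \<in> V" "b \<in> V"
  shows "\<bar>w a - w b\<bar> \<le> L * real (card V)"
proof -
  obtain e where e: "bij_betw e {..<card V} V"
    and le: "\<And>i j. i < card V \<Longrightarrow> j < card V \<Longrightarrow> \<bar>w (e i) - w (e j)\<bar> \<le> L * \<bar>real i - real j\<bar>"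
    using cut_connected_enumeration_lipschitz[of V R w L] fin conn lip by blast
  have "a \<in> e ` {..<card V}" "b \<in> e ` {..<card V}"
    using ab e by (simp_all add: bij_betw_def)
  then obtain i j where ij: "i < card V" "a = e i" "j < card V" "b = e j"
    by blast
  have "\<bar>w a - w b\<bar> \<le> L * \<bar>real i - real j\<bar>" using le ij by simp
  also have "\<dots> \<le> L * real (card V)" using ij L by (intro mult_left_mono) auto
  finally show ?thesis .
qed

section \<open>Tensorization\<close>

text \<open>
  Induction on the number of factors. Averaging over the first \<open>n\<close> coordinates leaves a function \<open>h\<close> of the last
  one, to which \<open>one_step\<close> applies; the induction hypothesis bounds \<open>J (h c)\<close> for every value \<open>c\<close> of the last
  coordinate, and Minkowski's inequality moves the remaining square root inside the average.

  The gradient of \<open>u\<close> is measured by a single function \<open>D\<close>, and \<open>D x\<close> has to control the increments on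
  the whole coordinate fibres through \<open>x\<close>. In this form the averaged \<open>D\<close> controls the increments of the
  averaged \<open>u\<close>, so that the hypotheses survive the induction. The number \<open>s D x\<close> bounds the standard
  deviation of \<open>u\<close> in each coordinate.
\<close>

lemma bobkov_tensorization:
  fixes V :: "nat \<Rightarrow> 'c set" and R :: "nat \<Rightarrow> 'c \<Rightarrow> 'c \<Rightarrow> bool"
    and u D :: "(nat \<Rightarrow> 'c) \<Rightarrow> real"
  assumes fin: "\<And>i. i \<in> {1..n} \<Longrightarrow> finite (V i)"
    and card: "\<And>i. i \<in> {1..n} \<Longrightarrow> card (V i) = k" and k: "1 \<le> k"
    and conn: "\<And>i. i \<in> {1..n} \<Longrightarrow> cut_connected (V i) (R i)"
    and s: "s = \<rho> * sqrt (((real k)\<^sup>2 - 1) / 12)" and rho: "0 \<le> \<rho>"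
    and one_step: "\<And>(A::'c set) h. finite A \<Longrightarrow> A \<noteq> {} \<Longrightarrow> h ` A \<subseteq> {lo..hi} \<Longrightarrow>
       (\<And>a b. a \<in> A \<Longrightarrow> b \<in> A \<Longrightarrow> \<bar>h a - h b\<bar> \<le> B * \<rho> * real k) \<Longrightarrow>
       J (avg A h) \<le> avg A (\<lambda>a. sqrt ((J (h a))\<^sup>2 + variance_on A h)) + err"
    and J: "\<And>p. 0 \<le> J p" and err: "0 \<le> err"
    and u: "\<And>x. x \<in> PiE {1..n} V \<Longrightarrow> u x \<in> {lo..hi}"
    and D: "\<And>x. x \<in> PiE {1..n} V \<Longrightarrow> D x \<in> {0..B}"
    and grad: "\<And>x i a b. x \<in> PiE {1..n} V \<Longrightarrow> i \<in> {1..n} \<Longrightarrow> a \<in> V i \<Longrightarrow> b \<in> V i \<Longrightarrow> R i a b \<Longrightarrow>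
       \<bar>u (x(i := a)) - u (x(i := b))\<bar> \<le> D x * \<rho>"
  shows "J (avg (PiE {1..n} V) u)
    \<le> avg (PiE {1..n} V) (\<lambda>x. sqrt ((J (u x))\<^sup>2 + real n * (s * D x)\<^sup>2)) + real n * err"
  using fin card conn u D grad
proof (induction n arbitrary: u D)
  case 0
  show ?case by (simp add: avg_def J)
next
  case (Suc n)
  let ?P = "PiE {1..n} V" and ?W = "V (Suc n)"
  note fin = Suc.prems(1) and card = Suc.prems(2) and conn = Suc.prems(3)
  have W: "finite ?W" "?W \<noteq> {}" "card ?W = k"
    using fin[of "Suc n"] card[of "Suc n"] k by auto
  have P: "finite ?P" "?P \<noteq> {}"
  proof -
    show "finite ?P" using fin by (intro finite_PiE) auto
    have "V i \<noteq> {}" if "i \<in> {1..n}" for i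
      using card[of i] k that by auto
    thus "?P \<noteq> {}" by (simp add: PiE_eq_empty_iff)
  qed
  have upd: "x(Suc n := c) \<in> PiE {1..Suc n} V" if "x \<in> ?P" "c \<in> ?W" for x c
    using that by (auto simp: PiE_iff extensional_def le_Suc_eq)
  define uc where "uc = (\<lambda>c x. u (x(Suc n := c)))"
  define Dc where "Dc = (\<lambda>c x. D (x(Suc n := c)))"
  define h where "h = (\<lambda>c. avg ?P (uc c))"
  define g where "g = (\<lambda>c. avg ?P (Dc c))"
  define F where "F = (\<lambda>c x. sqrt ((J (uc c x))\<^sup>2 + real n * (s * Dc c x)\<^sup>2))"
  have uc: "uc c x \<in> {lo..hi}" and Dc: "Dc c x \<in> {0..B}" if "x \<in> ?P" "c \<in> ?W" for x c
    using Suc.prems(4,5)[OF upd[OF that]] unfolding uc_def Dc_def by blast+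
  have s0: "0 \<le> s"
  proof -
    have "1\<^sup>2 \<le> (real k)\<^sup>2" using k by (intro power_mono) auto
    thus ?thesis using rho by (simp add: s)
  qed
  have IH: "J (h c) \<le> avg ?P (F c) + real n * err" if c: "c \<in> ?W" for c
    unfolding h_def F_def
  proof (rule Suc.IH)
    fix x i a b assume *: "x \<in> ?P" "i \<in> {1..n}" "a \<in> V i" "b \<in> V i" "R i a b"
    have "\<bar>u ((x(Suc n := c))(i := a)) - u ((x(Suc n := c))(i := b))\<bar> \<le> D (x(Suc n := c)) * \<rho>"
      using * by (intro Suc.prems(6) upd c) auto
    moreover have "(x(Suc n := c))(i := z) = (x(i := z))(Suc n := c)" for z
      using * by (intro fun_upd_twist) auto
    ultimately show "\<bar>uc c (x(i := a)) - uc c (x(i := b))\<bar> \<le> Dc c x * \<rho>"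
      by (simp add: uc_def Dc_def)
  qed (use fin card conn uc Dc c in auto)
  have g: "g c \<in> {0..B}" if "c \<in> ?W" for c
    unfolding g_def using Dc that by (intro avg_between P) auto
  have hlip: "\<bar>h a - h b\<bar> \<le> g c * \<rho>" if "a \<in> ?W" "b \<in> ?W" "c \<in> ?W" "R (Suc n) a b" for a b c
  proof -
    have "h a - h b = avg ?P (\<lambda>x. uc a x - uc b x)"
      by (simp add: h_def avg_diff)
    also have "\<bar>\<dots>\<bar> \<le> avg ?P (\<lambda>x. \<bar>uc a x - uc b x\<bar>)" by (rule abs_avg_le)
    also have "\<dots> \<le> avg ?P (\<lambda>x. \<rho> * Dc c x)"
    proof (rule avg_mono)
      fix x assume x: "x \<in> ?P"
      have "\<bar>u ((x(Suc n := c))(Suc n := a)) - u ((x(Suc n := c))(Suc n := b))\<bar> \<le> D (x(Suc n := c)) * \<rho>"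
        using that by (intro Suc.prems(6) upd x) auto
      thus "\<bar>uc a x - uc b x\<bar> \<le> \<rho> * Dc c x"
        unfolding uc_def Dc_def fun_upd_upd by (simp add: mult.commute)
    qed
    also have "\<dots> = g c * \<rho>" by (simp add: avg_cmult g_def)
    finally show ?thesis .
  qed
  have osc: "\<bar>h a - h b\<bar> \<le> B * \<rho> * real k" if ab: "a \<in> ?W" "b \<in> ?W" for a b
  proof -
    have "\<bar>h a - h b\<bar> \<le> B * \<rho> * real (card ?W)"
    proof (rule oscillation_cut_connected[OF W(1) conn _ _ ab])
      show "0 \<le> B * \<rho>" using g[OF ab(1)] rho by auto
      show "\<bar>h a' - h b'\<bar> \<le> B * \<rho>" if "a' \<in> ?W" "b' \<in> ?W" "R (Suc n) a' b'" for a' b'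
      proof -
        have "\<bar>h a' - h b'\<bar> \<le> g a' * \<rho>" using hlip that by blast
        also have "\<dots> \<le> B * \<rho>" using g[OF that(1)] rho by (intro mult_right_mono) auto
        finally show ?thesis .
      qed
    qed simp
    thus ?thesis by (simp add: W)
  qed
  have var: "variance_on ?W h \<le> (s * g c)\<^sup>2" if c: "c \<in> ?W" for c
  proof -
    have "1\<^sup>2 \<le> (real k)\<^sup>2" using k by (intro power_mono) auto
    moreover have "variance_on ?W h \<le> (g c * \<rho>)\<^sup>2 * (((real (card ?W))\<^sup>2 - 1) / 12)"
      by (rule variance_on_cut_connected[OF W(1,2) conn hlip]) (use c in auto)
    ultimately show ?thesis
      by (simp add: s W power_mult_distrib mult_ac)
  qed
  have "J (avg ?W h) \<le> avg ?W (\<lambda>c. sqrt ((J (h c))\<^sup>2 + variance_on ?W h)) + err"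
  proof (rule one_step[OF W(1,2) _ osc])
    show "h ` ?W \<subseteq> {lo..hi}"
      unfolding h_def using uc P by (intro image_subsetI avg_between) auto
  qed auto
  also have "\<dots> \<le> avg ?W (\<lambda>c. avg ?P (\<lambda>x. sqrt ((J (uc c x))\<^sup>2 + real (Suc n) * (s * Dc c x)\<^sup>2))
      + real n * err) + err"
  proof (intro add_right_mono avg_mono)
    fix c assume c: "c \<in> ?W"
    have F0: "0 \<le> avg ?P (F c)" unfolding F_def by (intro avg_nonneg) simp
    have "sqrt ((J (h c))\<^sup>2 + variance_on ?W h)
        \<le> sqrt ((avg ?P (F c) + real n * err)\<^sup>2 + (s * g c + 0)\<^sup>2)"
      using IH[OF c] var[OF c] J by (intro real_sqrt_le_mono add_mono power_mono) auto
    also have "\<dots> \<le> sqrt ((avg ?P (F c))\<^sup>2 + (s * g c)\<^sup>2) + sqrt ((real n * err)\<^sup>2 + 0\<^sup>2)"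
      by (rule real_sqrt_sum_squares_triangle_ineq)
    also have "sqrt ((real n * err)\<^sup>2 + 0\<^sup>2) = real n * err" using err by simp
    also have "sqrt ((avg ?P (F c))\<^sup>2 + (s * g c)\<^sup>2)
        = sqrt ((avg ?P (F c))\<^sup>2 + (avg ?P (\<lambda>x. s * Dc c x))\<^sup>2)"
      by (simp add: avg_cmult g_def)
    also have "\<dots> \<le> avg ?P (\<lambda>x. sqrt ((F c x)\<^sup>2 + (s * Dc c x)\<^sup>2))"
      by (rule avg_sqrt_minkowski)
    also have "\<dots> = avg ?P (\<lambda>x. sqrt ((J (uc c x))\<^sup>2 + real (Suc n) * (s * Dc c x)\<^sup>2))"
      by (intro avg_cong) (simp add: F_def algebra_simps)
    finally show "sqrt ((J (h c))\<^sup>2 + variance_on ?W h)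
        \<le> avg ?P (\<lambda>x. sqrt ((J (uc c x))\<^sup>2 + real (Suc n) * (s * Dc c x)\<^sup>2)) + real n * err"
      by simp
  qed
  also have "\<dots> = avg (PiE {1..Suc n} V) (\<lambda>x. sqrt ((J (u x))\<^sup>2 + real (Suc n) * (s * D x)\<^sup>2))
      + real (Suc n) * err"
    by (subst avg_PiE_Suc[OF fin])
       (auto simp: avg_add avg_const W uc_def Dc_def algebra_simps simp del: of_nat_Suc
             simp add: of_nat_Suc[of n])
  also have "avg ?W h = avg (PiE {1..Suc n} V) u"
    by (subst avg_PiE_Suc[OF fin]) (auto simp: h_def uc_def)
  finally show ?case .
qed

section \<open>Graphs and their products\<close>

lemma connected_graph_cut_connected:
  assumes "graph G" "Digraph_Component.connected G"
  shows "cut_connected (verts G) (\<lambda>a b. a \<rightarrow>\<^bsub>G\<^esub> b)"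
proof -
  interpret graph G by fact
  have sc: "strongly_connected G"
    using assms(2) sym_arcs by (rule symmetric_connected_imp_strongly_connected[rotated])
  have "\<exists>a\<in>S. \<exists>b\<in>verts G - S. a \<rightarrow>\<^bsub>G\<^esub> b" if S: "S \<subset> verts G" "S \<noteq> {}" for S
  proof -
    obtain u v where uv: "u \<in> S" "v \<in> verts G" "v \<notin> S" using S by blast
    have "u \<rightarrow>\<^sup>*\<^bsub>G\<^esub> v" using sc uv S by auto
    hence "v \<in> S \<or> (\<exists>a\<in>S. \<exists>b\<in>verts G - S. a \<rightarrow>\<^bsub>G\<^esub> b)"
    proof (induction rule: reachable_induct)
      case (step x y)
      thus ?case using adj_in_verts[OF step(2)] by blast
    qed (use uv in auto)
    thus ?thesis using uv by blast
  qed
  thus ?thesis by (auto simp: cut_connected_def)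
qed

context wf_digraph
begin

lemma unit_distance_nonneg: "0 \<le> \<mu> (\<lambda>_. 1) u v"
  unfolding \<mu>_def by (rule INF_greatest) (auto intro: pos_cost_pos_awalk_cost)

lemma graph_dist_self:
  assumes "u \<in> verts G"
  shows "graph_dist G u u = 0"
proof -
  have "\<mu> (\<lambda>_. 1) u u \<le> awalk_cost (\<lambda>_. 1) []"
    by (rule min_cost_le_walk_cost) (use assms in \<open>simp add: awalk_Nil_iff\<close>)
  hence "\<mu> (\<lambda>_. 1) u u = 0"
    using unit_distance_nonneg[of u u] by (simp add: zero_ereal_def[symmetric])
  thus ?thesis by (simp add: graph_dist_def)
qed

lemma graph_dist_adj_le_1:
  assumes "u \<rightarrow> v"
  shows "graph_dist G u v \<le> 1"
proof -
  obtain e where e: "e \<in> arcs G" "tail G e = u" "head G e = v"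
    using assms by (rule reachableE)
  have "\<mu> (\<lambda>_. 1) u v \<le> awalk_cost (\<lambda>_. 1) [e]"
    by (rule min_cost_le_walk_cost) (use e arc_implies_awalk[OF e(1)] in simp)
  hence "\<mu> (\<lambda>_. 1) u v \<le> 1"
    by (simp add: one_ereal_def)
  thus ?thesis
    using real_of_ereal_positive_mono[OF unit_distance_nonneg[of u v], of 1]
    by (simp add: graph_dist_def)
qed

end

lemma cart_prod_dist_edge_le_1:
  assumes G: "\<And>i. i \<in> {1..n} \<Longrightarrow> wf_digraph (G i)"
    and x: "x \<in> cart_prod_verts G n" and i: "i \<in> {1..n}" and ab: "a \<rightarrow>\<^bsub>G i\<^esub> b"
  shows "cart_prod_dist G n (x(i := a)) (x(i := b)) \<le> 1"
proof -
  have "graph_dist (G j) (x j) (x j) = 0" if "j \<in> {1..n} - {i}" for j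
    using wf_digraph.graph_dist_self[OF G, of j "x j"] that x by (auto simp: cart_prod_verts_def PiE_iff)
  hence "cart_prod_dist G n (x(i := a)) (x(i := b)) = graph_dist (G i) a b"
    unfolding cart_prod_dist_def using i by (subst sum.remove[of _ i]) auto
  also have "\<dots> \<le> 1"
    by (rule wf_digraph.graph_dist_adj_le_1[OF G[OF i] ab])
  finally show ?thesis .
qed

section \<open>The functional inequality in the limit\<close>

lemma scale_eps_sq: "k \<ge> 2 \<Longrightarrow> (scale_eps k n)\<^sup>2 = 12 / (((real k)\<^sup>2 - 1) * real n)"
proof -
  assume "k \<ge> 2"
  hence "1\<^sup>2 \<le> (real k)\<^sup>2" by (intro power_mono) auto
  thus ?thesis by (simp add: scale_eps_def)
qed

lemma scale_eps_nonneg: "k \<ge> 2 \<Longrightarrow> 0 \<le> scale_eps k n"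
proof -
  assume "k \<ge> 2"
  hence "1\<^sup>2 \<le> (real k)\<^sup>2" by (intro power_mono) auto
  thus ?thesis by (simp add: scale_eps_def)
qed

lemma scale_eps_tendsto_0: "k \<ge> 2 \<Longrightarrow> (\<lambda>n. scale_eps k n) \<longlonglongrightarrow> 0"
proof -
  have "(\<lambda>n. sqrt (12 / ((real k)\<^sup>2 - 1) / real n)) \<longlonglongrightarrow> sqrt 0"
    by (intro tendsto_real_sqrt lim_const_over_n)
  thus ?thesis by (simp add: scale_eps_def divide_divide_eq_left)
qed

text \<open>
  Here \<open>D x = \<bar>g' (F x)\<bar> + C k \<epsilon>\<^sub>n\<close>, where the second summand accounts for the variation of \<open>g'\<close> along a
  coordinate fibre. It tends to \<open>0\<close>, and so does the total error of the \<open>n\<close> one-coordinate inequalities, since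
  \<open>n \<epsilon>\<^sub>n\<^sup>2\<close> is constant and the factor \<open>\<kappa>\<close> is arbitrary.
\<close>

lemma product_bobkov:
  fixes V :: "nat \<Rightarrow> 'c set" and R :: "nat \<Rightarrow> 'c \<Rightarrow> 'c \<Rightarrow> bool" and g g' :: "real \<Rightarrow> real"
  assumes k: "k \<ge> 2" and fin: "\<And>i. i \<ge> 1 \<Longrightarrow> finite (V i)" and card: "\<And>i. i \<ge> 1 \<Longrightarrow> card (V i) = k"
    and conn: "\<And>i. i \<ge> 1 \<Longrightarrow> cut_connected (V i) (R i)"
    and g: "\<And>x. (g has_real_derivative g' x) (at x)" "\<And>x. g x \<in> {lo..hi}" "0 < lo" "hi < 1"
    and g': "\<And>x. \<bar>g' x\<bar> \<le> C" "\<And>x y. \<bar>g' x - g' y\<bar> \<le> C * \<bar>x - y\<bar>"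
    and tol: "0 < \<tau>"
  shows "\<forall>\<^sub>F n in sequentially. \<forall>F.
     (\<forall>x\<in>PiE {1..n} V. \<forall>i\<in>{1..n}. \<forall>a\<in>V i. \<forall>b\<in>V i. R i a b \<longrightarrow>
        \<bar>F (x(i := a)) - F (x(i := b))\<bar> \<le> scale_eps k n) \<longrightarrow>
     gauss_profile (avg (PiE {1..n} V) (\<lambda>x. g (F x))) \<le>
       avg (PiE {1..n} V) (\<lambda>x. sqrt ((gauss_profile (g (F x)))\<^sup>2 + (g' (F x))\<^sup>2)) + \<tau>"
proof -
  have C: "0 \<le> C" using g'(1)[of 0] by linarith
  define q where "q = ((real k)\<^sup>2 - 1) / 12"
  have "2\<^sup>2 \<le> (real k)\<^sup>2" using k by (intro power_mono) auto
  hence q: "0 < q" by (simp add: q_def)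
  define B where "B = C + C * real k"
  have B: "0 \<le> B" using C by (simp add: B_def)
  \<comment> \<open>Chosen so that \<open>n\<close> errors \<open>\<kappa> (B \<rho> k)\<^sup>2\<close> sum up to at most \<open>\<tau> / 2\<close>, as \<open>n \<rho>\<^sup>2 = 1 / q\<close>.\<close>
  define \<kappa> where "\<kappa> = \<tau> / 2 * q / (B\<^sup>2 * (real k)\<^sup>2 + 1)"
  have kap: "0 < \<kappa>" unfolding \<kappa>_def using tol q by (intro divide_pos_pos mult_pos_pos) (auto intro: add_nonneg_pos)
  obtain \<delta> where \<delta>: "0 < \<delta>" and step:
    "\<And>(A::'c set) h t. finite A \<Longrightarrow> A \<noteq> {} \<Longrightarrow> h ` A \<subseteq> {lo..hi} \<Longrightarrow>
       (\<And>a b. a \<in> A \<Longrightarrow> b \<in> A \<Longrightarrow> \<bar>h a - h b\<bar> \<le> t) \<Longrightarrow> t \<le> \<delta> \<Longrightarrow>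
       gauss_profile (avg A h) \<le> avg A (\<lambda>a. sqrt ((gauss_profile (h a))\<^sup>2 + variance_on A h)) + \<kappa> * t\<^sup>2"
    using gauss_profile_one_step[OF g(3,4) kap] by metis
  have lim: "(\<lambda>n. c * scale_eps k n) \<longlonglongrightarrow> 0" for c
    using tendsto_mult_left[OF scale_eps_tendsto_0[OF k], of c] by simp
  have "\<forall>\<^sub>F n in sequentially. 1 * scale_eps k n < 1"
    by (rule order_tendstoD(2)[OF lim]) simp
  moreover have "\<forall>\<^sub>F n in sequentially. (B * real k) * scale_eps k n < \<delta>"
    by (rule order_tendstoD(2)[OF lim]) (rule \<delta>)
  moreover have "\<forall>\<^sub>F n in sequentially. (C * real k) * scale_eps k n < \<tau> / 2"
    by (rule order_tendstoD(2)[OF lim]) (use tol in simp)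
  moreover have "\<forall>\<^sub>F n in sequentially. 1 \<le> n" by (rule eventually_ge_at_top)
  ultimately show ?thesis
  proof eventually_elim
    case (elim n)
    define \<rho> where "\<rho> = scale_eps k n"
    have \<rho>0: "0 \<le> \<rho>" unfolding \<rho>_def by (rule scale_eps_nonneg[OF k])
    have \<rho>1: "\<rho> \<le> 1" "B * \<rho> * real k \<le> \<delta>" "C * real k * \<rho> \<le> \<tau> / 2"
      using elim by (simp_all add: \<rho>_def mult_ac)
    have n\<rho>: "real n * \<rho>\<^sup>2 = 1 / q"
      using elim by (simp add: \<rho>_def scale_eps_sq[OF k] q_def)
    let ?P = "PiE {1..n} V"
    show ?case
    proof (intro allI impI)
      fix F
      assume lip: "\<forall>x\<in>?P. \<forall>i\<in>{1..n}. \<forall>a\<in>V i. \<forall>b\<in>V i. R i a b \<longrightarrow>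
        \<bar>F (x(i := a)) - F (x(i := b))\<bar> \<le> scale_eps k n"
      define D where "D = (\<lambda>x. \<bar>g' (F x)\<bar> + C * real k * \<rho>)"
      define s where "s = \<rho> * sqrt q"
      have s: "real n * (s * d)\<^sup>2 = d\<^sup>2" for d
        using n\<rho> q by (simp add: s_def power_mult_distrib mult.assoc[symmetric])
      have Ck: "0 \<le> C * real k * \<rho>" using C \<rho>0 by simp
      have near: "\<bar>F (x(i := a)) - F x\<bar> \<le> \<rho> * real k" if "x \<in> ?P" "i \<in> {1..n}" "a \<in> V i" for x i a
      proof -
        have xi: "x i \<in> V i" using that by (auto simp: PiE_iff)
        have "\<bar>F (x(i := a)) - F (x(i := x i))\<bar> \<le> \<rho> * real (card (V i))"
          by (rule oscillation_cut_connected[where w="\<lambda>a. F (x(i := a))", OF fin conn \<rho>0 _ that(3) xi])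
             (use that lip in \<open>auto simp: \<rho>_def\<close>)
        thus ?thesis using that card by simp
      qed
      have "gauss_profile (avg ?P (\<lambda>x. g (F x)))
        \<le> avg ?P (\<lambda>x. sqrt ((gauss_profile (g (F x)))\<^sup>2 + real n * (s * D x)\<^sup>2))
          + real n * (\<kappa> * (B * \<rho> * real k)\<^sup>2)"
      proof (rule bobkov_tensorization[where V=V and R=R and k=k and \<rho>=\<rho> and lo=lo and hi=hi and B=B])
        show "D x \<in> {0..B}" if "x \<in> ?P" for x
        proof -
          have "C * real k * \<rho> \<le> C * real k * 1" using \<rho>1 C by (intro mult_left_mono) auto
          thus ?thesis using g'(1)[of "F x"] Ck by (simp add: D_def B_def)
        qed
        fix x i a b
        assume *: "x \<in> ?P" "i \<in> {1..n}" "a \<in> V i" "b \<in> V i" "R i a b"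
        let ?y = "F (x(i := a))" and ?z = "F (x(i := b))"
        have "\<bar>g ?y - g ?z\<bar> \<le> D x * \<bar>?y - ?z\<bar>"
          unfolding real_norm_def[symmetric]
        proof (rule field_differentiable_bound[of "closed_segment ?z ?y" g g'])
          fix \<xi> assume \<xi>: "\<xi> \<in> closed_segment ?z ?y"
          show "(g has_real_derivative g' \<xi>) (at \<xi> within closed_segment ?z ?y)"
            using g(1) by (rule has_field_derivative_at_within)
          have "\<bar>\<xi> - F x\<bar> \<le> \<rho> * real k"
            using near[OF *(1-3)] near[OF *(1,2,4)] \<xi>
            by (auto simp: closed_segment_eq_real_ivl split: if_splits)
          hence "C * \<bar>\<xi> - F x\<bar> \<le> C * (\<rho> * real k)" using C by (rule mult_left_mono)
          thus "norm (g' \<xi>) \<le> D x"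
            using g'(2)[of \<xi> "F x"] by (simp add: D_def mult_ac)
        qed auto
        also have "\<dots> \<le> D x * \<rho>"
          using lip * Ck by (intro mult_left_mono) (auto simp: \<rho>_def D_def)
        finally show "\<bar>g ?y - g ?z\<bar> \<le> D x * \<rho>" .
      qed (use k fin card conn \<rho>0 \<rho>1(2) kap g(2) gauss_profile_pos in
            \<open>auto simp: s_def q_def less_imp_le intro: step\<close>)
      also have "avg ?P (\<lambda>x. sqrt ((gauss_profile (g (F x)))\<^sup>2 + real n * (s * D x)\<^sup>2))
        \<le> avg ?P (\<lambda>x. sqrt ((gauss_profile (g (F x)))\<^sup>2 + (g' (F x))\<^sup>2) + C * real k * \<rho>)"
      proof (rule avg_mono)
        fix x
        have "sqrt ((gauss_profile (g (F x)))\<^sup>2 + (D x)\<^sup>2)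
            \<le> sqrt ((gauss_profile (g (F x)))\<^sup>2 + (\<bar>g' (F x)\<bar>)\<^sup>2) + sqrt (0\<^sup>2 + (C * real k * \<rho>)\<^sup>2)"
          using real_sqrt_sum_squares_triangle_ineq[of "gauss_profile (g (F x))" 0 "\<bar>g' (F x)\<bar>" "C * real k * \<rho>"]
          by (simp add: D_def)
        thus "sqrt ((gauss_profile (g (F x)))\<^sup>2 + real n * (s * D x)\<^sup>2)
            \<le> sqrt ((gauss_profile (g (F x)))\<^sup>2 + (g' (F x))\<^sup>2) + C * real k * \<rho>"
          using Ck by (simp add: s)
      qed
      also have "\<dots> = avg ?P (\<lambda>x. sqrt ((gauss_profile (g (F x)))\<^sup>2 + (g' (F x))\<^sup>2)) + C * real k * \<rho>"
      proof -
        have "finite ?P" using fin by (intro finite_PiE) auto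
        moreover have "V i \<noteq> {}" if "i \<in> {1..n}" for i
          using card[of i] k that by auto
        hence "?P \<noteq> {}" by (simp add: PiE_eq_empty_iff)
        ultimately show ?thesis unfolding avg_add by (simp add: avg_const)
      qed
      also have "real n * (\<kappa> * (B * \<rho> * real k)\<^sup>2) = (real n * \<rho>\<^sup>2) * (\<kappa> * (B\<^sup>2 * (real k)\<^sup>2))"
        by (simp add: power_mult_distrib mult_ac)
      also have "\<dots> \<le> \<tau> / 2"
      proof -
        have "\<kappa> * (B\<^sup>2 * (real k)\<^sup>2) \<le> \<kappa> * (B\<^sup>2 * (real k)\<^sup>2 + 1)" using kap by simp
        also have "\<dots> = \<tau> / 2 * q"
          unfolding \<kappa>_def using add_nonneg_pos[of "B\<^sup>2 * (real k)\<^sup>2" 1] by (subst nonzero_eq_divide_eq[symmetric]) auto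
        finally show ?thesis using q by (simp add: n\<rho> field_simps)
      qed
      finally show "gauss_profile (avg ?P (\<lambda>x. g (F x)))
          \<le> avg ?P (\<lambda>x. sqrt ((gauss_profile (g (F x)))\<^sup>2 + (g' (F x))\<^sup>2)) + \<tau>"
        using \<rho>1(3) by linarith
    qed
  qed
qed

text \<open>
  All integrands are bounded continuous functions of \<open>f n x\<close>, so the two sides of \<open>product_bobkov\<close> converge to
  the corresponding integrals with respect to \<open>\<sigma>\<close>.
\<close>

lemma weak_limit_bobkov:
  fixes V :: "nat \<Rightarrow> 'c set" and R :: "nat \<Rightarrow> 'c \<Rightarrow> 'c \<Rightarrow> bool" and g g' :: "real \<Rightarrow> real"
    and f :: "nat \<Rightarrow> (nat \<Rightarrow> 'c) \<Rightarrow> real"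
  assumes k: "k \<ge> 2" and fin: "\<And>i. i \<ge> 1 \<Longrightarrow> finite (V i)" and card: "\<And>i. i \<ge> 1 \<Longrightarrow> card (V i) = k"
    and conn: "\<And>i. i \<ge> 1 \<Longrightarrow> cut_connected (V i) (R i)"
    and lip: "\<And>n x i a b. 1 \<le> n \<Longrightarrow> x \<in> PiE {1..n} V \<Longrightarrow> i \<in> {1..n} \<Longrightarrow> a \<in> V i \<Longrightarrow> b \<in> V i \<Longrightarrow>
        R i a b \<Longrightarrow> \<bar>f n (x(i := a)) - f n (x(i := b))\<bar> \<le> scale_eps k n"
    and r: "strict_mono r" and sigma: "real_distribution \<sigma>"
    and conv: "weak_conv_m (\<lambda>j. distr (uniform_count_measure (PiE {1..r j} V)) borel (f (r j))) \<sigma>"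
    and g: "\<And>x. (g has_real_derivative g' x) (at x)" "\<And>x. g x \<in> {lo..hi}" "0 < lo" "hi < 1"
    and g': "\<And>x. \<bar>g' x\<bar> \<le> C" "\<And>x y. \<bar>g' x - g' y\<bar> \<le> C * \<bar>x - y\<bar>"
  shows "gauss_profile (\<integral>x. g x \<partial>\<sigma>) \<le> (\<integral>x. sqrt ((gauss_profile (g x))\<^sup>2 + (g' x)\<^sup>2) \<partial>\<sigma>)"
proof -
  interpret \<sigma>: real_distribution \<sigma> by fact
  define P where "P = (\<lambda>n. PiE {1..n} V)"
  have P: "finite (P n)" "P n \<noteq> {}" for n
  proof -
    show "finite (P n)" unfolding P_def using fin by (intro finite_PiE) auto
    have "V i \<noteq> {}" if "i \<in> {1..n}" for i
      using card[of i] k that by auto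
    thus "P n \<noteq> {}" by (simp add: P_def PiE_eq_empty_iff)
  qed
  define \<nu> where "\<nu> = (\<lambda>j. distr (uniform_count_measure (P (r j))) borel (f (r j)))"
  define H where "H = (\<lambda>x. sqrt ((gauss_profile (g x))\<^sup>2 + (g' x)\<^sup>2))"
  have \<nu>: "real_distribution (\<nu> j)" for j
  proof -
    interpret prob_space "uniform_count_measure (P (r j))"
      by (rule prob_space_uniform_count_measure[OF P])
    show ?thesis unfolding \<nu>_def by (rule real_distribution_distr) (simp add: measurable_def space_uniform_count_measure sets_uniform_count_measure)
  qed
  have contg: "isCont g x" for x by (rule DERIV_isCont[OF g(1)])
  have contg': "isCont g' x" for x
  proof -
    have "C-lipschitz_on UNIV g'"
      using g'(2) g'(1)[of 0] by (auto simp: lipschitz_on_def dist_real_def)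
    thus ?thesis using lipschitz_on_continuous_on continuous_on_eq_continuous_at by blast
  qed
  have contH: "isCont H x" for x
  proof -
    have "isCont (\<lambda>x. gauss_profile (g x)) x"
      by (rule isCont_o2[OF contg isCont_gauss_profile]) (use g(2)[of x] g(3,4) in auto)
    thus ?thesis unfolding H_def using contg' by (intro continuous_intros)
  qed
  have int: "(\<integral>x. \<phi> x \<partial>\<nu> j) = avg (P (r j)) (\<lambda>x. \<phi> (f (r j) x))" if "\<And>x. isCont \<phi> x" for \<phi> :: "real \<Rightarrow> real" and j
  proof -
    have "\<phi> \<in> borel_measurable borel"
      using that by (intro borel_measurable_continuous_onI continuous_at_imp_continuous_on) auto
    thus ?thesis unfolding \<nu>_def
      by (subst integral_distr)
         (auto simp: measurable_def space_uniform_count_measure sets_uniform_count_measure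
           integral_uniform_count_measure[OF P(1)] avg_def)
  qed
  have H_bdd: "\<bar>H x\<bar> \<le> 1 + C" for x
  proof -
    have "H x \<le> gauss_profile (g x) + \<bar>g' x\<bar>"
      unfolding H_def using sqrt_sum_squares_le_sum_abs[of "gauss_profile (g x)" "g' x"] gauss_profile_pos[of "g x"] by simp
    thus ?thesis using gauss_profile_le_1[of "g x"] g'(1)[of x] by (simp add: H_def)
  qed
  have limg: "(\<lambda>j. \<integral>x. g x \<partial>\<nu> j) \<longlonglongrightarrow> (\<integral>x. g x \<partial>\<sigma>)"
  proof (rule weak_conv_imp_integral_bdd_continuous_conv[OF \<nu> sigma _ contg, where B=1])
    show "norm (g x) \<le> 1" for x
      using g(2)[of x] g(3,4) by simp
  qed (use conv in \<open>simp add: \<nu>_def P_def\<close>)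
  have limH: "(\<lambda>j. \<integral>x. H x \<partial>\<nu> j) \<longlonglongrightarrow> (\<integral>x. H x \<partial>\<sigma>)"
    by (rule weak_conv_imp_integral_bdd_continuous_conv[OF \<nu> sigma _ contH, where B="1 + C"])
       (use conv H_bdd in \<open>auto simp: \<nu>_def P_def\<close>)
  have "(\<integral>x. g x \<partial>\<sigma>) \<in> {lo..hi}"
  proof -
    have "(\<integral>x. g x \<partial>\<nu> j) \<in> {lo..hi}" for j
      unfolding int[OF contg] by (rule avg_between[OF P]) (rule g(2))
    hence "\<And>j. lo \<le> (\<integral>x. g x \<partial>\<nu> j)" "\<And>j. (\<integral>x. g x \<partial>\<nu> j) \<le> hi" by auto
    thus ?thesis
      using LIMSEQ_le_const[OF limg] LIMSEQ_le_const2[OF limg] by auto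
  qed
  hence "isCont gauss_profile (\<integral>x. g x \<partial>\<sigma>)"
    using g(3,4) by (intro isCont_gauss_profile) auto
  hence limI: "(\<lambda>j. gauss_profile (\<integral>x. g x \<partial>\<nu> j)) \<longlonglongrightarrow> gauss_profile (\<integral>x. g x \<partial>\<sigma>)"
    by (rule isCont_tendsto_compose[OF _ limg])
  have "gauss_profile (\<integral>x. g x \<partial>\<sigma>) \<le> (\<integral>x. H x \<partial>\<sigma>) + \<tau>" if \<tau>: "0 < \<tau>" for \<tau>
  proof (rule tendsto_le[OF sequentially_bot tendsto_add[OF limH tendsto_const] limI])
    have "filterlim r at_top sequentially"
      using r by (rule filterlim_subseq)
    moreover have "\<forall>\<^sub>F n in sequentially. (\<forall>F. (\<forall>x\<in>P n. \<forall>i\<in>{1..n}. \<forall>a\<in>V i. \<forall>b\<in>V i. R i a b \<longrightarrow>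
          \<bar>F (x(i := a)) - F (x(i := b))\<bar> \<le> scale_eps k n) \<longrightarrow>
        gauss_profile (avg (P n) (\<lambda>x. g (F x))) \<le> avg (P n) (\<lambda>x. H (F x)) + \<tau>) \<and> 1 \<le> n"
      unfolding P_def H_def
      by (intro eventually_conj product_bobkov[OF k fin card conn g g' \<tau>] eventually_ge_at_top) auto
    ultimately have "\<forall>\<^sub>F j in sequentially. (\<forall>F. (\<forall>x\<in>P (r j). \<forall>i\<in>{1..r j}. \<forall>a\<in>V i. \<forall>b\<in>V i. R i a b \<longrightarrow>
          \<bar>F (x(i := a)) - F (x(i := b))\<bar> \<le> scale_eps k (r j)) \<longrightarrow>
        gauss_profile (avg (P (r j)) (\<lambda>x. g (F x))) \<le> avg (P (r j)) (\<lambda>x. H (F x)) + \<tau>) \<and> 1 \<le> r j"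
      by (rule eventually_compose_filterlim[rotated])
    thus "\<forall>\<^sub>F j in sequentially. gauss_profile (\<integral>x. g x \<partial>\<nu> j) \<le> (\<integral>x. H x \<partial>\<nu> j) + \<tau>"
    proof eventually_elim
      case (elim j)
      have "gauss_profile (avg (P (r j)) (\<lambda>x. g (f (r j) x))) \<le> avg (P (r j)) (\<lambda>x. H (f (r j) x)) + \<tau>"
        using elim lip[of "r j"] unfolding P_def by blast
      thus ?case by (simp add: int contg contH)
    qed
  qed
  hence "gauss_profile (\<integral>x. g x \<partial>\<sigma>) \<le> (\<integral>x. H x \<partial>\<sigma>)"
    by (rule field_le_epsilon)
  thus ?thesis by (simp add: H_def)
qed

section \<open>Smoothed distribution functions\<close>

text \<open>
  For \<open>b = c s\<close> this is the distribution function at \<open>s\<close> of the convolution of \<open>\<sigma>\<close> with a centred Gaussian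
  measure of standard deviation \<open>1 / c\<close>.
\<close>

definition smoothed_cdf :: "real measure \<Rightarrow> real \<Rightarrow> real \<Rightarrow> real" where
  "smoothed_cdf \<sigma> c b = (\<integral>x. gauss_cdf (b - c * x) \<partial>\<sigma>)"

lemma gauss_cdf_linear_approx:
  "\<bar>gauss_cdf (y + t) - gauss_cdf y - t * std_normal_density y\<bar> \<le> t\<^sup>2"
proof -
  have "norm ((gauss_cdf (y + t) - t * std_normal_density y) - (gauss_cdf (y + 0) - 0 * std_normal_density y))
      \<le> \<bar>t\<bar> * norm (t - 0)"
  proof (rule field_differentiable_bound[of "closed_segment 0 t" _ "\<lambda>z. std_normal_density (y + z) - std_normal_density y"])
    fix z assume "z \<in> closed_segment 0 t"
    hence "\<bar>z\<bar> \<le> \<bar>t\<bar>" by (auto simp: closed_segment_eq_real_ivl split: if_splits)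
    thus "norm (std_normal_density (y + z) - std_normal_density y) \<le> \<bar>t\<bar>"
      using std_normal_density_lipschitz[of "y + z" y] by simp
    show "((\<lambda>z. gauss_cdf (y + z) - z * std_normal_density y) has_real_derivative
        std_normal_density (y + z) - std_normal_density y) (at z within closed_segment 0 t)"
      by (auto intro!: derivative_eq_intros DERIV_chain2[OF DERIV_gauss_cdf, THEN has_field_derivative_at_within])
  qed auto
  thus ?thesis by (simp add: power2_eq_square abs_mult_self_eq)
qed

context real_distribution
begin

lemma borel_measurable_gauss_cdf [measurable]: "gauss_cdf \<in> borel_measurable borel"
  by (intro borel_measurable_continuous_onI continuous_at_imp_continuous_on ballI isCont_gauss_cdf)

lemma integrable_gauss_cdf: "integrable M (\<lambda>x. gauss_cdf (b - c * x))"
  by (rule integrable_const_bound[where B=1])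
     (auto simp: gauss_cdf_bounds abs_of_pos less_imp_le)

lemma integrable_gauss_density: "integrable M (\<lambda>x. std_normal_density (b - c * x))"
  by (rule integrable_const_bound[where B=1])
     (auto simp: std_normal_density_le_1 std_normal_density_pos abs_of_pos)

lemma smoothed_cdf_bounds: "0 < smoothed_cdf M c b" "smoothed_cdf M c b < 1"
proof -
  show "0 < smoothed_cdf M c b"
    unfolding smoothed_cdf_def by (rule expectation_greater[OF integrable_gauss_cdf]) (simp add: gauss_cdf_bounds)
  show "smoothed_cdf M c b < 1"
    unfolding smoothed_cdf_def by (rule expectation_less[OF integrable_gauss_cdf]) (simp add: gauss_cdf_bounds)
qed

lemma DERIV_smoothed_cdf:
  "(smoothed_cdf M c has_real_derivative (\<integral>x. std_normal_density (b - c * x) \<partial>M)) (at b)"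
proof -
  let ?N = "smoothed_cdf M c" and ?N1 = "\<integral>x. std_normal_density (b - c * x) \<partial>M"
  have approx: "\<bar>?N (b + t) - ?N b - t * ?N1\<bar> \<le> t\<^sup>2" for t
  proof -
    define h where "h = (\<lambda>x. gauss_cdf (b + t - c * x) - gauss_cdf (b - c * x) - t * std_normal_density (b - c * x))"
    have int: "integrable M h"
      unfolding h_def
      by (intro Bochner_Integration.integrable_diff integrable_mult_right integrable_gauss_cdf integrable_gauss_density)
    have "?N (b + t) - ?N b - t * ?N1 = (\<integral>x. h x \<partial>M)"
      by (simp add: h_def smoothed_cdf_def integrable_gauss_cdf integrable_gauss_density)
    moreover have "\<bar>\<integral>x. h x \<partial>M\<bar> \<le> (\<integral>x. \<bar>h x\<bar> \<partial>M)"
      by (rule integral_abs_bound)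
    moreover have "(\<integral>x. \<bar>h x\<bar> \<partial>M) \<le> (\<integral>x. t\<^sup>2 \<partial>M)"
    proof (rule integral_mono)
      show "\<bar>h x\<bar> \<le> t\<^sup>2" for x
        using gauss_cdf_linear_approx[of "b - c * x" t] by (simp add: h_def algebra_simps)
    qed (use int in auto)
    moreover have "(\<integral>x. t\<^sup>2 \<partial>M) = t\<^sup>2"
      using prob_space by simp
    ultimately show ?thesis by linarith
  qed
  have "((\<lambda>t. (?N (b + t) - ?N b) / t - ?N1) \<longlongrightarrow> 0) (at 0)"
  proof (rule Lim_null_comparison)
    show "\<forall>\<^sub>F t in at 0. norm ((?N (b + t) - ?N b) / t - ?N1) \<le> \<bar>t\<bar>"
    proof (rule eventually_at_ball'[THEN eventually_mono, of 1])
      fix t :: real assume "t \<in> ball 0 1 \<and> t \<noteq> 0 \<and> t \<in> UNIV"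
      hence t: "t \<noteq> 0" by simp
      have "(?N (b + t) - ?N b) / t - ?N1 = (?N (b + t) - ?N b - t * ?N1) / t"
        using t by (simp add: field_simps)
      also have "\<bar>\<dots>\<bar> \<le> t\<^sup>2 / \<bar>t\<bar>" using approx[of t] by (simp add: abs_divide divide_right_mono)
      also have "\<dots> = \<bar>t\<bar>" using t by (simp add: power2_eq_square field_simps abs_if)
      finally show "norm ((?N (b + t) - ?N b) / t - ?N1) \<le> \<bar>t\<bar>" by simp
    qed simp
    show "((\<lambda>t::real. \<bar>t\<bar>) \<longlongrightarrow> 0) (at 0)"
      using tendsto_rabs[OF tendsto_ident_at, of 0 UNIV] by simp
  qed
  thus ?thesis unfolding DERIV_def by (rule LIM_zero_cancel)
qed

text \<open>
  The functional inequality for \<open>g x = gauss_cdf (b - c * x)\<close>, where \<open>g'\<^sup>2 = c\<^sup>2 I(g)\<^sup>2\<close>. The values of this \<open>g\<close>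
  come arbitrarily close to \<open>0\<close> and \<open>1\<close>; it is the limit of the admissible functions
  \<open>\<eta> + (1 - 2 \<eta>) g\<close> as \<open>\<eta>\<close> tends to \<open>0\<close>.
\<close>

lemma smoothed_cdf_profile_bound:
  assumes bobkov: "\<And>g g' lo hi C. (\<And>x. (g has_real_derivative g' x) (at x)) \<Longrightarrow> (\<And>x. g x \<in> {lo..hi}) \<Longrightarrow>
      0 < lo \<Longrightarrow> hi < 1 \<Longrightarrow> (\<And>x. \<bar>g' x\<bar> \<le> C) \<Longrightarrow> (\<And>x y. \<bar>g' x - g' y\<bar> \<le> C * \<bar>x - y\<bar>) \<Longrightarrow>
      gauss_profile (\<integral>x. g x \<partial>M) \<le> (\<integral>x. sqrt ((gauss_profile (g x))\<^sup>2 + (g' x)\<^sup>2) \<partial>M)"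
    and c: "0 \<le> c"
  shows "gauss_profile (smoothed_cdf M c b) \<le> sqrt (1 + c\<^sup>2) * (\<integral>x. std_normal_density (b - c * x) \<partial>M)"
proof -
  define \<eta> where "\<eta> = (\<lambda>n::nat. inverse (real (Suc (Suc (Suc n)))))"
  have \<eta>: "0 < \<eta> n" "\<eta> n < 1 / 2" for n by (simp_all add: \<eta>_def field_simps)
  have \<eta>_lim: "\<eta> \<longlonglongrightarrow> 0"
    unfolding \<eta>_def
    using LIMSEQ_inverse_real_of_nat LIMSEQ_Suc by blast
  define g where "g = (\<lambda>n x. \<eta> n + (1 - 2 * \<eta> n) * gauss_cdf (b - c * x))"
  define g' where "g' = (\<lambda>n x. - ((1 - 2 * \<eta> n) * c) * std_normal_density (b - c * x))"
  have g_bounds: "g n x \<in> {\<eta> n..1 - \<eta> n}" for n x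
  proof -
    have "0 \<le> (1 - 2 * \<eta> n) * gauss_cdf (b - c * x)" "(1 - 2 * \<eta> n) * gauss_cdf (b - c * x) \<le> (1 - 2 * \<eta> n) * 1"
      using \<eta>[of n] gauss_cdf_bounds[of "b - c * x"] by (intro mult_nonneg_nonneg mult_left_mono; simp)+
    thus ?thesis by (simp add: g_def)
  qed
  have fac: "\<bar>(1 - 2 * \<eta> n) * c\<bar> \<le> c" for n
    using \<eta>[of n] c mult_right_mono[of "1 - 2 * \<eta> n" 1 c] by (simp add: abs_mult)
  have g'_bound: "\<bar>g' n x\<bar> \<le> c" for n x
  proof -
    have "\<bar>g' n x\<bar> = \<bar>(1 - 2 * \<eta> n) * c\<bar> * std_normal_density (b - c * x)"
      using std_normal_density_pos[of "b - c * x"] by (simp add: g'_def abs_mult)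
    also have "\<dots> \<le> c * 1"
      using fac c std_normal_density_le_1 std_normal_density_pos[of "b - c * x"] by (intro mult_mono) auto
    finally show ?thesis by simp
  qed
  define H where "H = (\<lambda>n x. sqrt ((gauss_profile (g n x))\<^sup>2 + (g' n x)\<^sup>2))"
  have ineq: "gauss_profile (\<integral>x. g n x \<partial>M) \<le> (\<integral>x. H n x \<partial>M)" for n
    unfolding H_def
  proof (rule bobkov[of "g n" "g' n" "\<eta> n" "1 - \<eta> n" "c + c\<^sup>2"])
    show "(g n has_real_derivative g' n x) (at x)" for x
      unfolding g_def g'_def
      by (auto intro!: derivative_eq_intros DERIV_chain2[OF DERIV_gauss_cdf])
    show "\<bar>g' n x\<bar> \<le> c + c\<^sup>2" for x using g'_bound[of n x] c by (simp add: add_increasing2)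
    show "\<bar>g' n x - g' n y\<bar> \<le> (c + c\<^sup>2) * \<bar>x - y\<bar>" for x y
    proof -
      have "g' n x - g' n y = - ((1 - 2 * \<eta> n) * c) * (std_normal_density (b - c * x) - std_normal_density (b - c * y))"
        by (simp add: g'_def algebra_simps)
      hence "\<bar>g' n x - g' n y\<bar> = \<bar>(1 - 2 * \<eta> n) * c\<bar> * \<bar>std_normal_density (b - c * x) - std_normal_density (b - c * y)\<bar>"
        by (simp add: abs_mult)
      also have "\<dots> \<le> c * \<bar>(b - c * x) - (b - c * y)\<bar>"
        using fac c by (intro mult_mono std_normal_density_lipschitz) auto
      also have "(b - c * x) - (b - c * y) = c * (y - x)" by (simp add: algebra_simps)
      also have "c * \<bar>c * (y - x)\<bar> = c\<^sup>2 * \<bar>x - y\<bar>"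
        using c by (simp add: abs_mult power2_eq_square abs_minus_commute)
      also have "\<dots> \<le> (c + c\<^sup>2) * \<bar>x - y\<bar>" using c by (intro mult_right_mono) auto
      finally show ?thesis .
    qed
  qed (use \<eta> g_bounds in auto)
  have g_lim: "(\<lambda>n. g n x) \<longlonglongrightarrow> gauss_cdf (b - c * x)" for x
  proof -
    have "(\<lambda>n. g n x) \<longlonglongrightarrow> 0 + (1 - 2 * 0) * gauss_cdf (b - c * x)"
      unfolding g_def by (intro tendsto_intros \<eta>_lim)
    thus ?thesis by simp
  qed
  have "(\<lambda>n. \<integral>x. g n x \<partial>M) \<longlonglongrightarrow> smoothed_cdf M c b"
  proof -
    have "(\<integral>x. g n x \<partial>M) = \<eta> n + (1 - 2 * \<eta> n) * smoothed_cdf M c b" for n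
      using prob_space by (simp add: g_def smoothed_cdf_def integrable_gauss_cdf)
    moreover have "(\<lambda>n. \<eta> n + (1 - 2 * \<eta> n) * smoothed_cdf M c b) \<longlonglongrightarrow> 0 + (1 - 2 * 0) * smoothed_cdf M c b"
      by (intro tendsto_intros \<eta>_lim)
    ultimately show ?thesis by simp
  qed
  hence lhs: "(\<lambda>n. gauss_profile (\<integral>x. g n x \<partial>M)) \<longlonglongrightarrow> gauss_profile (smoothed_cdf M c b)"
    by (rule isCont_tendsto_compose[OF isCont_gauss_profile[OF smoothed_cdf_bounds]])
  have "(\<lambda>n. \<integral>x. H n x \<partial>M) \<longlonglongrightarrow> (\<integral>x. sqrt (1 + c\<^sup>2) * std_normal_density (b - c * x) \<partial>M)"
  proof (rule integral_dominated_convergence[where w="\<lambda>x. 1 + c"])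
    have "continuous_on UNIV (\<lambda>x. gauss_profile (g n x))" for n
    proof (intro continuous_at_imp_continuous_on ballI isCont_o2[of _ "g n" gauss_profile])
      fix x
      show "isCont (g n) x"
        unfolding g_def by (intro continuous_intros isCont_o2[OF _ isCont_gauss_cdf])
      show "isCont gauss_profile (g n x)"
        using g_bounds[of n x] \<eta>[of n] by (intro isCont_gauss_profile) auto
    qed
    hence [measurable]: "(\<lambda>x. gauss_profile (g n x)) \<in> borel_measurable borel" for n
      by (rule borel_measurable_continuous_onI)
    show "H n \<in> borel_measurable M" for n
      unfolding H_def g'_def by simp
    show "AE x in M. (\<lambda>n. H n x) \<longlonglongrightarrow> sqrt (1 + c\<^sup>2) * std_normal_density (b - c * x)"
    proof (rule AE_I2)
      fix x
      let ?p = "std_normal_density (b - c * x)"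
      have "(\<lambda>n. gauss_profile (g n x)) \<longlonglongrightarrow> gauss_profile (gauss_cdf (b - c * x))"
        by (rule isCont_tendsto_compose[OF isCont_gauss_profile[OF gauss_cdf_bounds] g_lim])
      moreover have "(\<lambda>n. g' n x) \<longlonglongrightarrow> - ((1 - 2 * 0) * c) * ?p"
        unfolding g'_def by (intro tendsto_intros \<eta>_lim)
      ultimately have "(\<lambda>n. H n x) \<longlonglongrightarrow> sqrt (?p\<^sup>2 + (- ((1 - 2 * 0) * c) * ?p)\<^sup>2)"
        unfolding H_def gauss_profile_cdf by (intro tendsto_intros)
      also have "?p\<^sup>2 + (- ((1 - 2 * 0) * c) * ?p)\<^sup>2 = (1 + c\<^sup>2) * ?p\<^sup>2"
        by (simp add: power_mult_distrib algebra_simps)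
      also have "sqrt \<dots> = sqrt (1 + c\<^sup>2) * ?p"
        using std_normal_density_pos[of "b - c * x"] by (simp add: real_sqrt_mult)
      finally show "(\<lambda>n. H n x) \<longlonglongrightarrow> sqrt (1 + c\<^sup>2) * ?p" .
    qed
    show "AE x in M. norm (H n x) \<le> 1 + c" for n
    proof (rule AE_I2)
      fix x
      have "H n x \<le> \<bar>gauss_profile (g n x)\<bar> + \<bar>g' n x\<bar>"
        unfolding H_def by (rule sqrt_sum_squares_le_sum_abs)
      also have "\<dots> \<le> 1 + c"
        using gauss_profile_le_1[of "g n x"] gauss_profile_pos[of "g n x"] g'_bound[of n x] by linarith
      finally show "norm (H n x) \<le> 1 + c" by (simp add: H_def)
    qed
  qed auto
  hence "(\<lambda>n. \<integral>x. H n x \<partial>M) \<longlonglongrightarrow> sqrt (1 + c\<^sup>2) * (\<integral>x. std_normal_density (b - c * x) \<partial>M)"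
    by simp
  from LIMSEQ_le[OF lhs this] show ?thesis using ineq by blast
qed

text \<open>
  Since \<open>gauss_quantile\<close> has derivative \<open>1 / gauss_profile\<close>, the hypothesis bounds the derivative of
  \<open>gauss_quantile \<circ> smoothed_cdf M c\<close> from below by \<open>1 / sqrt (1 + c\<^sup>2)\<close>.
\<close>

lemma smoothed_cdf_growth:
  assumes profile: "\<And>b. gauss_profile (smoothed_cdf M c b) \<le> sqrt (1 + c\<^sup>2) * (\<integral>x. std_normal_density (b - c * x) \<partial>M)"
    and t: "0 \<le> t" and a: "gauss_cdf a \<le> smoothed_cdf M c b"
  shows "gauss_cdf (a + t / sqrt (1 + c\<^sup>2)) \<le> smoothed_cdf M c (b + t)"
proof -
  define w where "w = sqrt (1 + c\<^sup>2)"
  have w: "0 < w" by (simp add: w_def add_pos_nonneg)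
  define Q where "Q = (\<lambda>b. gauss_quantile (smoothed_cdf M c b))"
  have Q: "gauss_cdf (Q b) = smoothed_cdf M c b" for b
    unfolding Q_def by (rule gauss_cdf_quantile[OF smoothed_cdf_bounds])
  have "Q b - b / w \<le> Q (b + t) - (b + t) / w"
  proof (rule DERIV_nonneg_imp_nondecreasing[where f="\<lambda>b. Q b - b / w"])
    fix z
    let ?N1 = "\<integral>x. std_normal_density (z - c * x) \<partial>M" and ?I = "gauss_profile (smoothed_cdf M c z)"
    have "((\<lambda>b. Q b - b / w) has_real_derivative 1 / ?I * ?N1 - 1 / w) (at z)"
      unfolding Q_def
      by (intro DERIV_diff DERIV_chain2[OF DERIV_gauss_quantile[OF smoothed_cdf_bounds] DERIV_smoothed_cdf]
          DERIV_cdivide DERIV_ident)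
    moreover have "0 \<le> 1 / ?I * ?N1 - 1 / w"
      using profile[of z] w gauss_profile_pos[of "smoothed_cdf M c z"] by (simp add: w_def[symmetric] field_simps)
    ultimately show "\<exists>y. ((\<lambda>b. Q b - b / w) has_real_derivative y) (at z) \<and> 0 \<le> y" by blast
  qed (use t in simp)
  moreover have "a \<le> Q b" using a by (simp add: Q[symmetric] gauss_cdf_le_iff)
  ultimately have "a + t / w \<le> Q (b + t)" by (simp add: add_divide_distrib)
  thus ?thesis by (simp add: Q[symmetric] gauss_cdf_le_iff w_def)
qed

text \<open>
  The limit counts an atom at \<open>s\<close> with weight \<open>1 / 2\<close>. The bounds by the left limit and the value of the
  distribution function suffice, since distinct points are compared later.
\<close>

lemma smoothed_cdf_tendsto:
  obtains L where "(\<lambda>n. smoothed_cdf M (real n) (real n * s)) \<longlonglongrightarrow> L"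
    "measure M {..<s} \<le> L" "L \<le> cdf M s"
proof -
  define h where "h = (\<lambda>x. if x < s then 1 else if x = s then gauss_cdf 0 else 0)"
  have h_bounds: "indicator {..<s} x \<le> h x" "h x \<le> indicator {..s} x" for x
    using gauss_cdf_bounds[of 0] by (auto simp: h_def)
  have [measurable]: "h \<in> borel_measurable borel"
    by (simp add: h_def)
  have lim: "(\<lambda>n. smoothed_cdf M (real n) (real n * s)) \<longlonglongrightarrow> (\<integral>x. h x \<partial>M)"
    unfolding smoothed_cdf_def
  proof (rule integral_dominated_convergence[where w="\<lambda>_. 1"])
    show "AE x in M. (\<lambda>n. gauss_cdf (real n * s - real n * x)) \<longlonglongrightarrow> h x"
    proof (rule AE_I2)
      fix x
      have eq: "real n * s - real n * x = real n * (s - x)" for n by (simp add: algebra_simps)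
      consider "x < s" | "x = s" | "s < x" by linarith
      thus "(\<lambda>n. gauss_cdf (real n * s - real n * x)) \<longlonglongrightarrow> h x"
        unfolding eq
      proof cases
        case 1
        hence "filterlim (\<lambda>n. real n * (s - x)) at_top sequentially"
          by (intro filterlim_at_top_mult_tendsto_pos[OF tendsto_const _ filterlim_real_sequentially]) simp
        thus "(\<lambda>n. gauss_cdf (real n * (s - x))) \<longlonglongrightarrow> h x"
          using filterlim_compose[OF gauss_cdf_at_top] 1 by (auto simp: h_def)
      next
        case 3
        hence "filterlim (\<lambda>n. real n * (x - s)) at_top sequentially"
          by (intro filterlim_at_top_mult_tendsto_pos[OF tendsto_const _ filterlim_real_sequentially]) simp
        hence "filterlim (\<lambda>n. - (real n * (x - s))) at_bot sequentially"
          by (simp add: filterlim_uminus_at_bot)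
        moreover have "- (real n * (x - s)) = real n * (s - x)" for n by (simp add: algebra_simps)
        ultimately show "(\<lambda>n. gauss_cdf (real n * (s - x))) \<longlonglongrightarrow> h x"
          using filterlim_compose[OF gauss_cdf_at_bot] 3 by (auto simp: h_def)
      qed (simp add: h_def)
    qed
    show "AE x in M. norm (gauss_cdf (real n * s - real n * x)) \<le> 1" for n
      by (auto simp: gauss_cdf_bounds abs_of_pos less_imp_le)
  qed auto
  have int: "integrable M h"
    by (rule integrable_const_bound[where B=1])
       (use gauss_cdf_bounds[of 0] in \<open>auto simp: h_def\<close>)
  have "(\<integral>x. indicator {..<s} x \<partial>M) \<le> (\<integral>x. h x \<partial>M)"
    by (intro integral_mono int h_bounds) (simp add: emeasure_eq_measure)
  moreover have "(\<integral>x. h x \<partial>M) \<le> (\<integral>x. indicator {..s} x \<partial>M)"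
    by (intro integral_mono int h_bounds) (simp add: emeasure_eq_measure)
  ultimately show thesis
    using that[OF lim] by (simp add: cdf_def)
qed

text \<open>
  The strict inequalities \<open>gauss_cdf a < cdf M s\<close> and \<open>s < s'\<close> absorb possible atoms of the limit measure.
\<close>

lemma cdf_growth:
  assumes profile: "\<And>c b. 0 \<le> c \<Longrightarrow> gauss_profile (smoothed_cdf M c b) \<le> sqrt (1 + c\<^sup>2) * (\<integral>x. std_normal_density (b - c * x) \<partial>M)"
    and a: "gauss_cdf a < cdf M s" and s: "s < s'" and t: "0 \<le> t"
  shows "gauss_cdf (a + t) \<le> cdf M (s' + t)"
proof -
  \<comment> \<open>Smoothing with \<open>c = n\<close> and moving \<open>b\<close> by \<open>n t\<close> shifts the Gaussian quantile by at least
    \<open>n t / sqrt (1 + n\<^sup>2)\<close>, which tends to \<open>t\<close>.\<close>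
  obtain L where L: "(\<lambda>n. smoothed_cdf M (real n) (real n * s')) \<longlonglongrightarrow> L" "measure M {..<s'} \<le> L"
    using smoothed_cdf_tendsto by blast
  obtain L' where L': "(\<lambda>n. smoothed_cdf M (real n) (real n * (s' + t))) \<longlonglongrightarrow> L'" "L' \<le> cdf M (s' + t)"
    using smoothed_cdf_tendsto by blast
  have "cdf M s \<le> measure M {..<s'}"
    unfolding cdf_def using s by (intro finite_measure_mono) auto
  hence "gauss_cdf a < L" using a L(2) by linarith
  hence "\<forall>\<^sub>F n in sequentially. gauss_cdf a < smoothed_cdf M (real n) (real n * s')"
    by (rule order_tendstoD(1)[OF L(1)])
  hence ev: "\<forall>\<^sub>F n in sequentially. gauss_cdf (a + real n * t / sqrt (1 + (real n)\<^sup>2))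
      \<le> smoothed_cdf M (real n) (real n * (s' + t))"
  proof eventually_elim
    case (elim n)
    thus ?case
      using smoothed_cdf_growth[OF profile, of "real n" "real n * t" a "real n * s'"] t
      by (simp add: distrib_left)
  qed
  have "(\<lambda>n. real n / sqrt (1 + (real n)\<^sup>2)) \<longlonglongrightarrow> 1"
    by real_asymp
  hence "(\<lambda>n. a + real n / sqrt (1 + (real n)\<^sup>2) * t) \<longlonglongrightarrow> a + 1 * t"
    by (intro tendsto_intros)
  hence "(\<lambda>n. gauss_cdf (a + real n * t / sqrt (1 + (real n)\<^sup>2))) \<longlonglongrightarrow> gauss_cdf (a + t)"
    by (intro isCont_tendsto_compose[OF isCont_gauss_cdf]) simp
  from tendsto_le[OF sequentially_bot L'(1) this ev] L'(2) show ?thesis by linarith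
qed

end

section \<open>The monotone transport map\<close>

lemma measure_supp_std_normal: "measure_supp std_normal_distribution = UNIV"
proof -
  have "0 < emeasure std_normal_distribution U" if U: "open U" "x \<in> U" for U and x :: real
  proof -
    interpret real_distribution std_normal_distribution
      by (rule real_dist_normal_dist)
    obtain e where e: "0 < e" "ball x e \<subseteq> U" using U open_contains_ball by blast
    have "0 < gauss_cdf (x + e / 2) - gauss_cdf (x - e / 2)"
      using e(1) by (simp add: gauss_cdf_less_iff)
    also have "\<dots> = measure std_normal_distribution {x - e / 2<..x + e / 2}"
      using e(1) by (simp add: gauss_cdf_def cdf_diff_eq)
    also have "\<dots> \<le> measure std_normal_distribution U"
      using e U by (intro finite_measure_mono) (auto simp: dist_real_def subset_iff abs_if)
    finally show ?thesis by (simp add: emeasure_eq_measure)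
  qed
  thus ?thesis by (auto simp: measure_supp_def)
qed

text \<open>
  The quantile function of \<open>\<sigma>\<close> composed with \<open>gauss_cdf\<close> is monotone and pushes the Gaussian measure forward to
  \<open>\<sigma>\<close>. In terms of the Galois connection between quantiles and distribution functions, the growth
  condition is its Lipschitz property. It maps into the support because it is continuous and the Gaussian
  measure charges every nonempty open set.
\<close>

lemma std_normal_dominates:
  assumes \<sigma>: "real_distribution \<sigma>"
    and growth: "\<And>a s s' t. gauss_cdf a < cdf \<sigma> s \<Longrightarrow> s < s' \<Longrightarrow> 0 \<le> t \<Longrightarrow> gauss_cdf (a + t) \<le> cdf \<sigma> (s' + t)"
  shows "std_normal_distribution \<succ>' \<sigma>"
proof -
  interpret \<sigma>: cdf_distribution \<sigma>
    unfolding cdf_distribution_def by (rule \<sigma>)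
  interpret \<gamma>: real_distribution std_normal_distribution
    by (rule real_dist_normal_dist)
  define T where "T = (\<lambda>a. Inf {x. gauss_cdf a \<le> cdf \<sigma> x})"
  have T: "T a \<le> x \<longleftrightarrow> gauss_cdf a \<le> cdf \<sigma> x" for a x
    unfolding T_def by (rule \<sigma>.pseudoinverse[OF gauss_cdf_bounds, symmetric])
  have mono: "T a \<le> T b" if "a \<le> b" for a b
  proof -
    have "gauss_cdf a \<le> gauss_cdf b" using that by (simp add: gauss_cdf_le_iff)
    also have "\<dots> \<le> cdf \<sigma> (T b)" using T by blast
    finally show ?thesis by (simp add: T)
  qed
  have step: "T (a + t) \<le> T a + t" if t: "0 \<le> t" for a t
  proof (rule field_le_epsilon)
    fix e :: real assume e: "0 < e"
    \<comment> \<open>The growth condition needs strict inequalities, so start from \<open>a - e / 2\<close> and \<open>T a + e / 2\<close>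
      and compensate by the longer step \<open>t + e / 2\<close>.\<close>
    have "gauss_cdf (a - e / 2) < gauss_cdf a" using e by (simp add: gauss_cdf_less_iff)
    also have "gauss_cdf a \<le> cdf \<sigma> (T a)" using T by blast
    finally have "gauss_cdf (a - e / 2 + (t + e / 2)) \<le> cdf \<sigma> (T a + e / 2 + (t + e / 2))"
      using e t by (intro growth) auto
    thus "T (a + t) \<le> T a + t + e" by (simp add: T add.commute add.left_commute)
  qed
  have lip: "1-lipschitz_on UNIV T"
  proof (rule lipschitz_onI)
    fix x y :: real
    show "dist (T x) (T y) \<le> 1 * dist x y"
    proof (cases "x \<le> y")
      case True
      thus ?thesis using step[of "y - x" x] mono[of x y] by (simp add: dist_real_def)
    next
      case False
      thus ?thesis using step[of "x - y" y] mono[of y x] by (simp add: dist_real_def)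
    qed
  qed simp
  have cont: "continuous_on UNIV T" using lip by (rule lipschitz_on_continuous_on)
  hence [measurable]: "T \<in> borel_measurable borel" by (rule borel_measurable_continuous_onI)
  have distr: "distr std_normal_distribution borel T = \<sigma>"
  proof (rule cdf_unique[OF _ \<sigma>])
    show "real_distribution (distr std_normal_distribution borel T)" by simp
    show "cdf (distr std_normal_distribution borel T) = cdf \<sigma>"
    proof
      fix x
      have "cdf (distr std_normal_distribution borel T) x
          = measure std_normal_distribution {a. gauss_cdf a \<le> cdf \<sigma> x}"
        unfolding cdf_def[of "distr _ _ _"] by (subst measure_distr) (auto simp: T vimage_def)
      also have "\<dots> = cdf \<sigma> x"
      proof -
        consider "cdf \<sigma> x = 0" | "cdf \<sigma> x = 1" | "0 < cdf \<sigma> x" "cdf \<sigma> x < 1"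
          using \<sigma>.cdf_nonneg[of x] \<sigma>.cdf_bounded_prob[of x] by linarith
        thus ?thesis
        proof cases
          case 1
          hence "{a. gauss_cdf a \<le> cdf \<sigma> x} = {}" using gauss_cdf_bounds(1) by (auto simp: not_le)
          thus ?thesis using 1 by simp
        next
          case 2
          hence "{a. gauss_cdf a \<le> cdf \<sigma> x} = space std_normal_distribution"
            using gauss_cdf_bounds(2) by (auto intro: less_imp_le)
          thus ?thesis using 2 \<gamma>.prob_space by simp
        next
          case 3
          define q where "q = gauss_quantile (cdf \<sigma> x)"
          have q: "gauss_cdf q = cdf \<sigma> x" unfolding q_def by (rule gauss_cdf_quantile[OF 3])
          hence "{a. gauss_cdf a \<le> cdf \<sigma> x} = {..q}" by (auto simp: q[symmetric] gauss_cdf_le_iff)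
          thus ?thesis using q by (simp add: gauss_cdf_def cdf_def)
        qed
      qed
      finally show "cdf (distr std_normal_distribution borel T) x = cdf \<sigma> x" .
    qed
  qed
  have supp: "T a \<in> measure_supp \<sigma>" for a
    unfolding measure_supp_def
  proof (intro CollectI allI impI)
    fix U assume U: "open U" "T a \<in> U"
    have "open (T -` U)" using cont U(1) by (simp add: continuous_on_open_vimage)
    moreover have "a \<in> T -` U" using U(2) by simp
    ultimately have "0 < emeasure std_normal_distribution (T -` U)"
      using measure_supp_std_normal by (auto simp: measure_supp_def)
    also have "emeasure std_normal_distribution (T -` U) = emeasure (distr std_normal_distribution borel T) U"
      using U(1) by (subst emeasure_distr) auto
    finally show "0 < emeasure \<sigma> U" by (simp add: distr)
  qed
  have "restrict_space std_normal_distribution UNIV = std_normal_distribution"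
    by (rule measure_eqI) (auto simp: sets_restrict_space emeasure_restrict_space)
  thus ?thesis
    unfolding iso_Lipschitz_dominates_def measure_supp_std_normal
    using supp mono lip distr by (intro exI[of _ T]) (auto simp: mono_on_def)
qed

section \<open>Domination by the Gaussian measure\<close>

theorem theorem1p14:
  fixes G :: "nat \<Rightarrow> ('a, 'b) pre_digraph"
    and k :: nat
    and f :: "nat \<Rightarrow> (nat \<Rightarrow> 'a) \<Rightarrow> real"
    and r :: "nat \<Rightarrow> nat"
    and \<sigma> :: "real measure"
  assumes "k \<ge> 2"
    and "\<And>i. i \<ge> 1 \<Longrightarrow> graph (G i)"
    and "\<And>i. i \<ge> 1 \<Longrightarrow> Digraph_Component.connected (G i)"
    and "\<And>i. i \<ge> 1 \<Longrightarrow> card (verts (G i)) = k"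
    and "\<And>n. n \<ge> 1 \<Longrightarrow>
      one_Lipschitz (cart_prod_verts G n) (\<lambda>x y. scale_eps k n * cart_prod_dist G n x y) (f n)"
    and "strict_mono r" and "\<And>i. r i \<ge> 1"
    and "real_distribution \<sigma>"
    and "weak_conv_m (\<lambda>i. distr (cart_prod_measure G (r i)) borel (f (r i))) \<sigma>"
  shows "std_normal_distribution \<succ>' \<sigma>"
proof -
  interpret \<sigma>: real_distribution \<sigma> by fact
  have wf: "wf_digraph (G i)" if "i \<ge> 1" for i
  proof -
    interpret graph "G i" using assms(2) that .
    show ?thesis by unfold_locales
  qed
  have fin: "finite (verts (G i))" if "i \<ge> 1" for i
    using assms(1) assms(4)[of i] that by (intro card_ge_0_finite) simp
  have conn: "cut_connected (verts (G i)) (\<lambda>a b. a \<rightarrow>\<^bsub>G i\<^esub> b)" if "i \<ge> 1" for i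
    using assms(2,3) that by (intro connected_graph_cut_connected)
  have lip: "\<bar>f n (x(i := a)) - f n (x(i := b))\<bar> \<le> scale_eps k n"
    if "1 \<le> n" and x: "x \<in> PiE {1..n} (\<lambda>i. verts (G i))" and i: "i \<in> {1..n}"
      and ab: "a \<in> verts (G i)" "b \<in> verts (G i)" and arc: "a \<rightarrow>\<^bsub>G i\<^esub> b" for n x i a b
  proof -
    have upd: "x(i := c) \<in> cart_prod_verts G n" if "c \<in> verts (G i)" for c
      using x i that by (auto simp: cart_prod_verts_def PiE_iff extensional_def)
    have "\<bar>f n (x(i := a)) - f n (x(i := b))\<bar> \<le> scale_eps k n * cart_prod_dist G n (x(i := a)) (x(i := b))"
      using assms(5)[OF \<open>1 \<le> n\<close>] upd ab unfolding one_Lipschitz_def by blast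
    also have "\<dots> \<le> scale_eps k n * 1"
    proof (intro mult_left_mono scale_eps_nonneg assms(1))
      show "cart_prod_dist G n (x(i := a)) (x(i := b)) \<le> 1"
        using wf x i arc by (intro cart_prod_dist_edge_le_1) (auto simp: cart_prod_verts_def)
    qed
    finally show ?thesis by simp
  qed
  have bobkov: "gauss_profile (\<integral>x. g x \<partial>\<sigma>) \<le> (\<integral>x. sqrt ((gauss_profile (g x))\<^sup>2 + (g' x)\<^sup>2) \<partial>\<sigma>)"
    if "\<And>x. (g has_real_derivative g' x) (at x)" "\<And>x. g x \<in> {lo..hi}" "0 < lo" "hi < 1"
      "\<And>x. \<bar>g' x\<bar> \<le> C" "\<And>x y. \<bar>g' x - g' y\<bar> \<le> C * \<bar>x - y\<bar>" for g g' lo hi C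
  proof (rule weak_limit_bobkov[where V="\<lambda>i. verts (G i)" and R="\<lambda>i a b. a \<rightarrow>\<^bsub>G i\<^esub> b"
        and k=k and f=f and r=r and lo=lo and hi=hi and C=C])
    show "weak_conv_m (\<lambda>j. distr (uniform_count_measure (PiE {1..r j} (\<lambda>i. verts (G i)))) borel (f (r j))) \<sigma>"
      using assms(9) by (simp add: cart_prod_measure_def cart_prod_verts_def)
  qed (fact assms(1) fin assms(4) conn lip assms(6) assms(8) that)+
  have profile: "gauss_profile (smoothed_cdf \<sigma> c b)
      \<le> sqrt (1 + c\<^sup>2) * (\<integral>x. std_normal_density (b - c * x) \<partial>\<sigma>)" if "0 \<le> c" for c b
    by (rule \<sigma>.smoothed_cdf_profile_bound[OF _ that]) (rule bobkov)
  show ?thesis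
    by (rule std_normal_dominates[OF assms(8)]) (rule \<sigma>.cdf_growth[OF profile])
qed

end
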